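(* Let $(f_k)$ be a sequence in $\mathcal L^1_E$ and $f_0\in\mathcal L^1_E$. Then $(f_k)$ converges in the Pettis norm to $f_0$ if and only if (1) $(f_k)$ is Pettis uniformly integrable; (2) $(f_k)$ satisfies the sequential Pettis Bocce criterion; and (3) $\lim_k\|m_B(f_k)-m_B(f_0)\|=0$ for each $B\in\mathcal F^+$.
   Context: $(E,\|\cdot\|)$ is a Banach space with dual $E^*$ and dual closed unit ball $B_{E^*}$, and $(\Omega,\mathcal F,\mu)$ is a probability space. $\mathcal F^+$ is the collection of sets in $\mathcal F$ with strictly positive measure, and for $B\in\mathcal F$, $\mathcal F^+(B)$ is the collection of measurable subsets of $B$ with strictly positive measure. $\mathcal L^1_E$ is the (prequotient) space of Bochner $\mu$-integrable functions $f:\Omega\to E$. The Pettis (semi)norm on $\mathcal L^1_E$ is $\|f\|_{\text{Pettis}}=\sup_{x^*\in B_{E^*}}\int_\Omega|x^*(f)|\,d\mu$. For $f\in\mathcal L^1_E$ (or $\mathcal L^1_{\mathbb R}$) and $A\in\mathcal F$, put $m_A(f):=\frac{1}{\mu(A)}\int_A f\,d\mu$ and $\text{Bocce-osc } f|_A:=\frac{1}{\mu(A)}\int_A\|f-m_A(f)\|\,d\mu$ (with $0/0=0$). Put $\text{Pettis-Bocce-osc } f|_A:=\sup_{x^*\in B_{E^*}}\text{Bocce-osc } x^*(f)|_A$. A sequence $(f_k)$ in $\mathcal L^1_E$ satisfies the sequential Pettis Bocce criterion if for each subsequence $(f_{k_j})$, each $\epsilon>0$ and each $B\in\mathcal F^+$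 there is $A\in\mathcal F^+(B)$ such that $\liminf_j\text{Pettis-Bocce-osc } f_{k_j}|_A<\epsilon$. A subset $H\subset\mathcal L^1_{\mathbb R}$ is uniformly integrable if $\lim_{c\to\infty}\sup_{h\in H}\int_{\{|h|\ge c\}}|h|\,d\mu=0$. A subset $K$ of $\mathcal L^1_E$ is Pettis uniformly integrable if $\{x^*(f): x^*\in B_{E^*}, f\in K\}$ is a uniformly integrable subset of $\mathcal L^1_{\mathbb R}$. *)

theory Defs
  imports "HOL-Probability.Probability"
begin

section \<open>Bochner integration without separability\<close>

text \<open>
  The library's \<open>has_bochner_integral\<close> and \<open>integrable\<close> are restricted to value types of class
  \<open>second_countable_topology\<close>, that is, to separable spaces. Here the value space is an arbitrary
  Banach space, so the notions are introduced again, with Borel measurability replaced by strong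
  measurability: almost everywhere convergence of a sequence of simple functions. The measure is
  not assumed complete, so that such a function agrees only almost everywhere with a measurable
  one. Integrals of nonnegative functions are therefore taken as \<open>nn_integral\<close>, which does not
  change when its integrand is modified on a null set, whether or not the integrand is measurable.
\<close>

definition strongly_measurable :: "'a measure \<Rightarrow> ('a \<Rightarrow> 'b::real_normed_vector) \<Rightarrow> bool" where
  "strongly_measurable M f \<longleftrightarrow>
     (\<exists>s. (\<forall>i::nat. simple_function M (s i)) \<and> (AE x in M. (\<lambda>i. s i x) \<longlonglongrightarrow> f x))"

definition bochner_has_integral ::
  "'a measure \<Rightarrow> ('a \<Rightarrow> 'b::real_normed_vector) \<Rightarrow> 'b \<Rightarrow> bool" where
  "bochner_has_integral M f I \<longleftrightarrow>
     strongly_measurable M f \<and>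
     (\<exists>s. (\<forall>i::nat. Bochner_Integration.simple_bochner_integrable M (s i)) \<and>
          (\<lambda>i. \<integral>\<^sup>+x. ennreal (norm (f x - s i x)) \<partial>M) \<longlonglongrightarrow> 0 \<and>
          (\<lambda>i. Bochner_Integration.simple_bochner_integral M (s i)) \<longlonglongrightarrow> I)"

definition bochner_integrable :: "'a measure \<Rightarrow> ('a \<Rightarrow> 'b::real_normed_vector) \<Rightarrow> bool" where
  "bochner_integrable M f \<longleftrightarrow> (\<exists>I. bochner_has_integral M f I)"

definition bochner_integral :: "'a measure \<Rightarrow> ('a \<Rightarrow> 'b::real_normed_vector) \<Rightarrow> 'b" where
  "bochner_integral M f = (THE I. bochner_has_integral M f I)"

lemma norm_simple_bochner_integral_le:
  fixes f :: "'a \<Rightarrow> 'b::real_normed_vector"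
  assumes "Bochner_Integration.simple_bochner_integrable M f"
  shows "ennreal (norm (Bochner_Integration.simple_bochner_integral M f)) \<le> (\<integral>\<^sup>+x. ennreal (norm (f x)) \<partial>M)"
proof -
  have *: "Bochner_Integration.simple_bochner_integrable M (\<lambda>x. norm (f x))"
    using simple_bochner_integrable_compose2[where p = "\<lambda>x y. norm x", OF _ assms assms] by simp
  have "ennreal (norm (Bochner_Integration.simple_bochner_integral M f))
      \<le> ennreal (Bochner_Integration.simple_bochner_integral M (\<lambda>x. norm (f x)))"
    by (intro ennreal_leI simple_bochner_integral_norm_bound assms)
  also have "\<dots> = (\<integral>\<^sup>+x. ennreal (norm (f x)) \<partial>M)"
    by (rule simple_bochner_integral_eq_nn_integral[OF *]) simp
  finally show ?thesis .
qed

lemma nn_integral_norm_triangle: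
  fixes f :: "'a \<Rightarrow> 'b::real_normed_vector"
  assumes f: "strongly_measurable M f"
    and s: "simple_function M s" and t: "simple_function M t"
  shows "(\<integral>\<^sup>+x. ennreal (norm (s x - t x)) \<partial>M)
    \<le> (\<integral>\<^sup>+x. ennreal (norm (f x - s x)) \<partial>M) + (\<integral>\<^sup>+x. ennreal (norm (f x - t x)) \<partial>M)"
proof -
  obtain u where u: "\<And>i::nat. simple_function M (u i)"
    and lim: "AE x in M. (\<lambda>i. u i x) \<longlonglongrightarrow> f x"
    using f by (auto simp: strongly_measurable_def)
  have *: "\<exists>g. g \<in> borel_measurable M \<and> (AE x in M. ennreal (norm (f x - s x)) = g x)"
    if s: "simple_function M s" for s
  proof (intro exI conjI)
    have "simple_function M (\<lambda>x. ennreal (norm (u i x - s x)))" for i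
      by (rule simple_function_compose2[OF u s, where h = "\<lambda>x y. ennreal (norm (x - y))"])
    then show "(\<lambda>x. liminf (\<lambda>i. ennreal (norm (u i x - s x)))) \<in> borel_measurable M"
      by (intro borel_measurable_liminf borel_measurable_simple_function)
    show "AE x in M. ennreal (norm (f x - s x)) = liminf (\<lambda>i. ennreal (norm (u i x - s x)))"
      using lim
    proof eventually_elim
      fix x assume "(\<lambda>i. u i x) \<longlonglongrightarrow> f x"
      then have "(\<lambda>i. ennreal (norm (u i x - s x))) \<longlonglongrightarrow> ennreal (norm (f x - s x))"
        by (intro tendsto_intros)
      then show "ennreal (norm (f x - s x)) = liminf (\<lambda>i. ennreal (norm (u i x - s x)))"
        by (intro lim_imp_Liminf[symmetric] trivial_limit_sequentially)
    qed
  qed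
  obtain g where g [measurable]: "g \<in> borel_measurable M"
    and fg: "AE x in M. ennreal (norm (f x - s x)) = g x"
    using *[OF s] by blast
  obtain h where h [measurable]: "h \<in> borel_measurable M"
    and fh: "AE x in M. ennreal (norm (f x - t x)) = h x"
    using *[OF t] by blast
  have "(\<integral>\<^sup>+x. ennreal (norm (s x - t x)) \<partial>M) \<le> (\<integral>\<^sup>+x. g x + h x \<partial>M)"
  proof (intro nn_integral_mono_AE)
    show "AE x in M. ennreal (norm (s x - t x)) \<le> g x + h x"
      using fg fh
    proof eventually_elim
      fix x assume gx: "ennreal (norm (f x - s x)) = g x" and hx: "ennreal (norm (f x - t x)) = h x"
      have "norm (s x - t x) \<le> norm (f x - s x) + norm (f x - t x)"
        using norm_triangle_ineq4[of "f x - t x" "f x - s x"] by (simp add: add.commute)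
      then show "ennreal (norm (s x - t x)) \<le> g x + h x"
        unfolding gx[symmetric] hx[symmetric] by (simp flip: ennreal_plus)
    qed
  qed
  also have "\<dots> = (\<integral>\<^sup>+x. g x \<partial>M) + (\<integral>\<^sup>+x. h x \<partial>M)"
    by (rule nn_integral_add) auto
  also have "(\<integral>\<^sup>+x. g x \<partial>M) = (\<integral>\<^sup>+x. ennreal (norm (f x - s x)) \<partial>M)"
    using fg by (intro nn_integral_cong_AE) auto
  also have "(\<integral>\<^sup>+x. h x \<partial>M) = (\<integral>\<^sup>+x. ennreal (norm (f x - t x)) \<partial>M)"
    using fh by (intro nn_integral_cong_AE) auto
  finally show ?thesis .
qed

lemma bochner_has_integral_unique:
  assumes "bochner_has_integral M f I" and "bochner_has_integral M f J"
  shows "I = J"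
proof -
  have f: "strongly_measurable M f"
    using assms by (simp add: bochner_has_integral_def)
  obtain s where s: "\<And>i::nat. Bochner_Integration.simple_bochner_integrable M (s i)"
    and s0: "(\<lambda>i. \<integral>\<^sup>+x. ennreal (norm (f x - s i x)) \<partial>M) \<longlonglongrightarrow> 0"
    and sI: "(\<lambda>i. Bochner_Integration.simple_bochner_integral M (s i)) \<longlonglongrightarrow> I"
    using assms(1) unfolding bochner_has_integral_def by blast
  obtain t where t: "\<And>i::nat. Bochner_Integration.simple_bochner_integrable M (t i)"
    and t0: "(\<lambda>i. \<integral>\<^sup>+x. ennreal (norm (f x - t i x)) \<partial>M) \<longlonglongrightarrow> 0"
    and tJ: "(\<lambda>i. Bochner_Integration.simple_bochner_integral M (t i)) \<longlonglongrightarrow> J"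
    using assms(2) unfolding bochner_has_integral_def by blast
  have le: "ennreal (norm (Bochner_Integration.simple_bochner_integral M (s i) - Bochner_Integration.simple_bochner_integral M (t i)))
    \<le> (\<integral>\<^sup>+x. ennreal (norm (f x - s i x)) \<partial>M) + (\<integral>\<^sup>+x. ennreal (norm (f x - t i x)) \<partial>M)" for i
  proof -
    have "Bochner_Integration.simple_bochner_integral M (s i) - Bochner_Integration.simple_bochner_integral M (t i)
        = Bochner_Integration.simple_bochner_integral M (\<lambda>x. s i x - t i x)"
      by (rule simple_bochner_integral_diff[OF s t, symmetric])
    moreover have "Bochner_Integration.simple_bochner_integrable M (\<lambda>x. s i x - t i x)"
      using simple_bochner_integrable_compose2[of "(-)" M "s i" "t i"] s t by simp
    ultimately have "ennreal (norm (Bochner_Integration.simple_bochner_integral M (s i) - Bochner_Integration.simple_bochner_integral M (t i)))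
        \<le> (\<integral>\<^sup>+x. ennreal (norm (s i x - t i x)) \<partial>M)"
      using norm_simple_bochner_integral_le by metis
    also have "\<dots> \<le> (\<integral>\<^sup>+x. ennreal (norm (f x - s i x)) \<partial>M) + (\<integral>\<^sup>+x. ennreal (norm (f x - t i x)) \<partial>M)"
      using s t by (intro nn_integral_norm_triangle[OF f]) (auto elim: simple_bochner_integrable.cases)
    finally show ?thesis .
  qed
  have "(\<lambda>i. ennreal (norm (Bochner_Integration.simple_bochner_integral M (s i) - Bochner_Integration.simple_bochner_integral M (t i)))) \<longlonglongrightarrow> 0"
    by (rule tendsto_sandwich[OF always_eventually always_eventually tendsto_const])
       (use le tendsto_add[OF s0 t0] in auto)
  moreover have "(\<lambda>i. ennreal (norm (Bochner_Integration.simple_bochner_integral M (s i) - Bochner_Integration.simple_bochner_integral M (t i))))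
      \<longlonglongrightarrow> ennreal (norm (I - J))"
    by (intro tendsto_intros sI tJ)
  ultimately have "ennreal (norm (I - J)) = 0"
    using LIMSEQ_unique by blast
  then show ?thesis
    by (simp add: ennreal_eq_0_iff)
qed

lemma bochner_integral_eq:
  "bochner_has_integral M f I \<Longrightarrow> bochner_integral M f = I"
  unfolding bochner_integral_def by (rule the_equality) (auto dest: bochner_has_integral_unique)

lemma has_bochner_integral_imp_bochner_has_integral:
  assumes "has_bochner_integral M f I"
  shows "bochner_has_integral M f I"
  using assms
proof cases
  case (1 s)
  obtain F where "\<And>i::nat. simple_function M (F i)" and "\<And>x. x \<in> space M \<Longrightarrow> (\<lambda>i. F i x) \<longlonglongrightarrow> f x"
    using borel_measurable_implies_sequence_metric[OF 1(1), of 0] by blast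
  then have "strongly_measurable M f"
    unfolding strongly_measurable_def by (intro exI[of _ F]) auto
  with 1 show ?thesis
    unfolding bochner_has_integral_def by blast
qed

corollary bochner_integral_eq_lebesgue_integral:
  assumes "integrable M f"
  shows "bochner_integrable M f" and "bochner_integral M f = integral\<^sup>L M f"
  using has_bochner_integral_imp_bochner_has_integral[OF has_bochner_integral_integrable[OF assms]]
  by (auto simp: bochner_integrable_def bochner_integral_eq)


section \<open>Pettis norm and Bocce oscillation\<close>

text \<open>
  The dual of \<open>'b\<close> is \<open>'b \<Rightarrow>\<^sub>L real\<close>, and \<open>cball 0 1\<close> is its closed unit ball. Norms, oscillations
  and their suprema are taken in \<^typ>\<open>ennreal\<close>, where suprema and \<open>liminf\<close> always exist; there
  \<open>0 / 0 = 0\<close>.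
\<close>

definition pettis_norm :: "'a measure \<Rightarrow> ('a \<Rightarrow> 'b::real_normed_vector) \<Rightarrow> ennreal" where
  "pettis_norm M f =
     (SUP x' \<in> cball (0 :: 'b \<Rightarrow>\<^sub>L real) 1. \<integral>\<^sup>+x. ennreal \<bar>blinfun_apply x' (f x)\<bar> \<partial>M)"

definition pos_sets :: "'a measure \<Rightarrow> 'a set set" where
  "pos_sets M = {A \<in> sets M. measure M A > 0}"

definition mean_on :: "'a measure \<Rightarrow> 'a set \<Rightarrow> ('a \<Rightarrow> 'b::real_normed_vector) \<Rightarrow> 'b" where
  "mean_on M A f = (1 / measure M A) *\<^sub>R bochner_integral M (\<lambda>x. indicator A x *\<^sub>R f x)"

definition bocce_osc :: "'a measure \<Rightarrow> 'a set \<Rightarrow> ('a \<Rightarrow> 'b::real_normed_vector) \<Rightarrow> ennreal" where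
  "bocce_osc M A f = (\<integral>\<^sup>+x\<in>A. ennreal (norm (f x - mean_on M A f)) \<partial>M) / emeasure M A"

definition pettis_bocce_osc ::
  "'a measure \<Rightarrow> 'a set \<Rightarrow> ('a \<Rightarrow> 'b::real_normed_vector) \<Rightarrow> ennreal" where
  "pettis_bocce_osc M A f =
     (SUP x' \<in> cball (0 :: 'b \<Rightarrow>\<^sub>L real) 1. bocce_osc M A (\<lambda>x. blinfun_apply x' (f x)))"

definition seq_pettis_bocce ::
  "'a measure \<Rightarrow> (nat \<Rightarrow> 'a \<Rightarrow> 'b::real_normed_vector) \<Rightarrow> bool" where
  "seq_pettis_bocce M f \<longleftrightarrow>
     (\<forall>r. strict_mono r \<longrightarrow>
       (\<forall>\<epsilon>>0. \<forall>B \<in> pos_sets M. \<exists>A \<in> pos_sets M. A \<subseteq> B \<and>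
          liminf (\<lambda>j. pettis_bocce_osc M A (f (r j))) < ennreal \<epsilon>))"

definition uniformly_integrable :: "'a measure \<Rightarrow> ('a \<Rightarrow> real) set \<Rightarrow> bool" where
  "uniformly_integrable M H \<longleftrightarrow>
     ((\<lambda>c::real. SUP h\<in>H. \<integral>\<^sup>+x\<in>{x. \<bar>h x\<bar> \<ge> c}. ennreal \<bar>h x\<bar> \<partial>M) \<longlongrightarrow> 0) at_top"

definition pettis_uniformly_integrable ::
  "'a measure \<Rightarrow> ('a \<Rightarrow> 'b::real_normed_vector) set \<Rightarrow> bool" where
  "pettis_uniformly_integrable M K \<longleftrightarrow>
     uniformly_integrable M
       {(\<lambda>x. blinfun_apply x' (f x)) | x' f. x' \<in> cball (0 :: 'b \<Rightarrow>\<^sub>L real) 1 \<and> f \<in> K}"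

end

theory Submission
  imports Defs
begin

text \<open>
  If \<open>f k\<close> converges to \<open>f0\<close>, (1) and (2) are inherited from \<open>f0\<close>, which is integrable and almost
  constant on some subset of positive measure of any given set; (3) needs Hahn--Banach. Conversely, apply the Bocce
  criterion repeatedly along a subsequence violating convergence and diagonalize: this yields a further
  subsequence and disjoint sets \<open>A n\<close>, filling the space up to a null set, on each of which all
  \<open>x'(f k)\<close> eventually oscillate little. By (3), \<open>x'(f k)\<close> converges to \<open>x'(f0)\<close> when integrated over any
  set, so by weak lower semicontinuity \<open>x'(f0)\<close> oscillates little on \<open>A n\<close> as well. On finitely many of
  the \<open>A n\<close> both functions are then close to their means, which are close to each other uniformly in
  \<open>x'\<close>, and uniform integrability controls the rest.
\<close>

section \<open>Norming functionals\<close>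

text \<open>The Pettis norm is a supremum over the dual ball, so in the sufficiency proof the sets,
  the tail level \<open>c\<close>, the number \<open>N\<close> of sets used and the index
  \<open>j\<close> must all be chosen before \<open>x'\<close>. This is possible because the Bocce
  criterion yields one set for all \<open>x'\<close>, the tail level is common to all
  \<open>x'\<close> and \<open>k\<close>, and (3) is norm convergence of finitely many means. The
  criterion says nothing about \<open>f0\<close>. Weak convergence is tested on sets that depend on
  \<open>x'\<close>, so no rate uniform in \<open>x'\<close> is available there; lower
  semicontinuity asks for none, and it carries both the oscillation bounds and the bound on the
  uncovered set over to \<open>f0\<close>. Only a \<open>liminf\<close> is controlled, so the good
  indices for a set form an infinite set depending on that set. Each new set thins the indices
  again, which is why a diagonal sequence is taken. Strong measurability is an almost everywhere
  notion, so the work is done on representatives that are everywhere limits of simple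
  functions.\<close>

text \<open>Hahn--Banach by Zorn's lemma, with partial functionals encoded by their graphs \<open>G\<close>: subspaces on
  which \<open>a \<le> norm x\<close> for every \<open>(x, a)\<close>, which forces \<open>G\<close> to be single-valued.\<close>

lemma hahn_banach_maximal_graph:
  fixes v :: "'b::real_normed_vector"
  obtains G :: "('b \<times> real) set" where "subspace G" "(v, norm v) \<in> G"
    "\<And>x a. (x, a) \<in> G \<Longrightarrow> a \<le> norm x" "\<And>y. \<exists>c. (y, c) \<in> G"
proof -
  define \<A> where "\<A> = {G :: ('b \<times> real) set. subspace G \<and> (v, norm v) \<in> G \<and> (\<forall>x a. (x, a) \<in> G \<longrightarrow> a \<le> norm x)}"
  have base: "span {(v, norm v)} \<in> \<A>"
  proof -
    have "t * norm v \<le> norm (t *\<^sub>R v)" for t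
      by (simp add: mult_right_mono)
    then show ?thesis
      unfolding \<A>_def by (intro CollectI conjI subspace_span span_base) (auto simp: span_singleton)
  qed
  have "\<exists>G\<in>\<A>. \<forall>X\<in>\<A>. G \<subseteq> X \<longrightarrow> X = G"
  proof (rule subset_Zorn_nonempty)
    show "\<A> \<noteq> {}" using base by auto
  next
    fix \<C> assume ne: "\<C> \<noteq> {}" and chain: "subset.chain \<A> \<C>"
    have sub: "\<C> \<subseteq> \<A>" and tot: "\<And>X Y. X \<in> \<C> \<Longrightarrow> Y \<in> \<C> \<Longrightarrow> X \<subseteq> Y \<or> Y \<subseteq> X"
      using chain by (auto simp: subset_chain_def)
    have "subspace (\<Union>\<C>)"
      unfolding subspace_def
    proof (intro conjI ballI allI)
      show "0 \<in> \<Union>\<C>"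
        using ne sub by (auto simp: \<A>_def subspace_def)
      fix p q assume "p \<in> \<Union>\<C>" "q \<in> \<Union>\<C>"
      then obtain X Y where X: "X \<in> \<C>" "p \<in> X" and Y: "Y \<in> \<C>" "q \<in> Y" by auto
      then obtain Z where "Z \<in> \<C>" "p \<in> Z" "q \<in> Z"
        using tot by blast
      then show "p + q \<in> \<Union>\<C>"
        using sub by (auto simp: \<A>_def intro: subspace_add)
    next
      fix c p assume "p \<in> \<Union>\<C>"
      then show "c *\<^sub>R p \<in> \<Union>\<C>"
        using sub by (auto simp: \<A>_def intro: subspace_scale)
    qed
    then show "\<Union>\<C> \<in> \<A>"
      using ne sub unfolding \<A>_def by blast
  qed
  then obtain G where GA: "G \<in> \<A>" and max: "\<And>X. X \<in> \<A> \<Longrightarrow> G \<subseteq> X \<Longrightarrow> X = G" by blast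
  have G: "subspace G" "(v, norm v) \<in> G" and le: "\<And>x a. (x, a) \<in> G \<Longrightarrow> a \<le> norm x"
    using GA by (auto simp: \<A>_def)
  have "\<exists>c. (y, c) \<in> G" for y
  proof -
    \<comment> \<open>The value \<open>c\<close> at \<open>y\<close> must satisfy
      \<open>a - norm (x - y) \<le> c \<le> norm (x + y) - a\<close> over \<open>G\<close>. Each
      lower bound is below each upper bound by \<open>bd\<close>, so the supremum of the lower ones
      fits.\<close>
    define L where "L = (\<lambda>(x, a). a - norm (x - y)) ` G"
    have bd: "a - norm (x - y) \<le> norm (x' + y) - a'" if "(x, a) \<in> G" "(x', a') \<in> G" for x a x' a'
    proof -
      have "(x + x', a + a') \<in> G"
        using subspace_add[OF G(1) that] by simp
      then have "a + a' \<le> norm ((x - y) + (x' + y))"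
        using le by simp
      also have "\<dots> \<le> norm (x - y) + norm (x' + y)"
        by (rule norm_triangle_ineq)
      finally show ?thesis by simp
    qed
    have Lne: "L \<noteq> {}" and Lbd: "bdd_above L"
      using G(2) bd[OF _ G(2)] by (auto simp: L_def intro!: bdd_aboveI)
    define c where "c = Sup L"
    have lo: "a - norm (x - y) \<le> c" if "(x, a) \<in> G" for x a
      unfolding c_def using that by (intro cSup_upper Lbd) (auto simp: L_def)
    have hi: "c \<le> norm (x + y) - a" if "(x, a) \<in> G" for x a
      unfolding c_def using that bd by (intro cSup_least Lne) (auto simp: L_def)
    \<comment> \<open>Dividing by \<open>\<bar>t\<bar>\<close> reduces to \<open>t = 1\<close>,
      which is \<open>hi\<close>, and \<open>t = -1\<close>, which is \<open>lo\<close>.\<close>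
    have ext: "a + t * c \<le> norm (x + t *\<^sub>R y)" if xa: "(x, a) \<in> G" for x a t
    proof (cases t "0 :: real" rule: linorder_cases)
      case equal then show ?thesis using le[OF xa] by simp
    next
      case greater
      have "(x /\<^sub>R t, a / t) \<in> G"
        using subspace_scale[OF G(1) xa, of "1 / t"] by (simp add: divide_inverse mult.commute)
      from hi[OF this] have "t * c \<le> t * (norm (x /\<^sub>R t + y) - a / t)"
        using greater by (intro mult_left_mono) auto
      also have "\<dots> = norm (t *\<^sub>R (x /\<^sub>R t + y)) - a"
        using greater by (simp add: right_diff_distrib)
      finally show ?thesis using greater by (simp add: algebra_simps)
    next
      case less
      have "(x /\<^sub>R (-t), a / (-t)) \<in> G"
        using subspace_scale[OF G(1) xa, of "1 / (-t)"] by (simp add: divide_inverse mult.commute)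
      from lo[OF this] have "(-t) * (a / (-t) - norm (x /\<^sub>R (-t) - y)) \<le> (-t) * c"
        using less by (intro mult_left_mono) auto
      moreover have "(-t) * (a / (-t) - norm (x /\<^sub>R (-t) - y)) = a - norm ((-t) *\<^sub>R (x /\<^sub>R (-t) - y))"
        using less by (simp add: right_diff_distrib)
      ultimately show ?thesis using less by (simp add: algebra_simps)
    qed
    have "span (insert (y, c) G) \<in> \<A>"
      unfolding \<A>_def
    proof (intro CollectI conjI allI impI)
      show "(v, norm v) \<in> span (insert (y, c) G)" using G by (auto intro: span_base)
      fix x a assume "(x, a) \<in> span (insert (y, c) G)"
      then obtain t where "(x, a) - t *\<^sub>R (y, c) \<in> span G"
        unfolding span_insert by auto
      then have "(x - t *\<^sub>R y, a - t * c) \<in> G"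
        using G(1) by (simp add: span_eq_iff[THEN iffD2])
      from ext[OF this, of t] show "a \<le> norm x" by simp
    qed simp
    then have "span (insert (y, c) G) = G"
      by (rule max) (auto intro: span_base)
    then have "(y, c) \<in> G" using span_base[of "(y, c)" "insert (y, c) G"] by simp
    then show ?thesis ..
  qed
  with G le show ?thesis using that by blast
qed

text \<open>Two values over the same point differ by a value over 0, which is at most 0 in both
  orders; so the total maximal graph is a function. Its one-sided bound at \<open>x\<close> and at
  \<open>- x\<close> gives the norm estimate.\<close>

lemma exists_norming_functional:
  fixes v :: "'b::real_normed_vector"
  obtains x' :: "'b \<Rightarrow>\<^sub>L real" where "norm x' \<le> 1" "blinfun_apply x' v = norm v"
proof -
  obtain G :: "('b \<times> real) set" where G: "subspace G" "(v, norm v) \<in> G"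
    and le: "\<And>x a. (x, a) \<in> G \<Longrightarrow> a \<le> norm x" and "\<And>y. \<exists>c. (y, c) \<in> G"
    using hahn_banach_maximal_graph by blast
  then obtain \<phi> where \<phi>: "\<And>y. (y, \<phi> y) \<in> G" by metis
  have uniq: "a = b" if "(x, a) \<in> G" "(x, b) \<in> G" for x a b
    using le[of 0 "a - b"] le[of 0 "b - a"] subspace_diff[OF G(1) that] subspace_diff[OF G(1) that(2,1)] by simp
  have bl: "bounded_linear \<phi>"
  proof (rule bounded_linear_intro)
    show "\<phi> (x + y) = \<phi> x + \<phi> y" for x y
      using uniq[OF \<phi>] subspace_add[OF G(1) \<phi> \<phi>, of x y] by simp
    show "\<phi> (r *\<^sub>R x) = r *\<^sub>R \<phi> x" for r x
      using uniq[OF \<phi>] subspace_scale[OF G(1) \<phi>, of r x] by simp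
    show "norm (\<phi> x) \<le> norm x * 1" for x
      using le[OF \<phi>, of x] le[of "- x" "- \<phi> x"] subspace_neg[OF G(1) \<phi>, of x] by simp
  qed
  show ?thesis
  proof
    show "norm (Blinfun \<phi>) \<le> 1"
      using le[OF \<phi>] le[of "- x" "- \<phi> x" for x] subspace_neg[OF G(1) \<phi>]
      by (intro norm_blinfun_bound) (auto simp: bounded_linear_Blinfun_apply[OF bl] abs_le_iff)
    show "blinfun_apply (Blinfun \<phi>) v = norm v"
      using uniq[OF \<phi> G(2)] by (simp add: bounded_linear_Blinfun_apply[OF bl])
  qed
qed

section \<open>Pointwise limits of simple functions\<close>

text \<open>Convergence on the whole space, and not just almost everywhere as in \<^const>\<open>strongly_measurable\<close>,
  makes norms and functionals of such functions measurable although \<open>M\<close> need not be complete.\<close>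

definition simple_limit :: "'a measure \<Rightarrow> ('a \<Rightarrow> 'b::real_normed_vector) \<Rightarrow> bool" where
  "simple_limit M f \<longleftrightarrow>
     (\<exists>s. (\<forall>i::nat. simple_function M (s i)) \<and> (\<forall>x\<in>space M. (\<lambda>i. s i x) \<longlonglongrightarrow> f x))"

lemma simple_limit_simple: "simple_function M f \<Longrightarrow> simple_limit M f"
  unfolding simple_limit_def by (intro exI[of _ "\<lambda>_. f"]) auto

lemma simple_limit_compose2:
  fixes h :: "'b::real_normed_vector \<Rightarrow> 'c::real_normed_vector \<Rightarrow> 'd::real_normed_vector"
  assumes "simple_limit M f" "simple_limit M g" and h: "continuous_on UNIV (\<lambda>(x, y). h x y)"
  shows "simple_limit M (\<lambda>x. h (f x) (g x))"
proof -
  obtain s t where s: "\<And>i. simple_function M (s i)" "\<And>x. x \<in> space M \<Longrightarrow> (\<lambda>i::nat. s i x) \<longlonglongrightarrow> f x"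
    and t: "\<And>i. simple_function M (t i)" "\<And>x. x \<in> space M \<Longrightarrow> (\<lambda>i::nat. t i x) \<longlonglongrightarrow> g x"
    using assms(1,2) unfolding simple_limit_def by blast
  show ?thesis
    unfolding simple_limit_def
  proof (intro exI conjI allI ballI)
    show "simple_function M (\<lambda>x. h (s i x) (t i x))" for i
      by (rule simple_function_compose2[OF s(1) t(1)])
    show "(\<lambda>i. h (s i x) (t i x)) \<longlonglongrightarrow> h (f x) (g x)" if "x \<in> space M" for x
      using continuous_on_tendsto_compose[OF h tendsto_Pair[OF s(2) t(2)], OF that that] by simp
  qed
qed

lemma simple_limit_compose:
  fixes h :: "'b::real_normed_vector \<Rightarrow> 'd::real_normed_vector"
  assumes "simple_limit M f" and h: "continuous_on UNIV h"
  shows "simple_limit M (\<lambda>x. h (f x))"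
  by (rule simple_limit_compose2[OF assms(1) assms(1), of "\<lambda>x y. h x"])
    (auto simp: split_def intro!: continuous_on_compose2[OF h] continuous_intros)

lemma simple_limit_borel_measurable:
  "simple_limit M f \<Longrightarrow> f \<in> borel_measurable M"
  unfolding simple_limit_def
  using borel_measurable_LIMSEQ_metric borel_measurable_simple_function by metis

text \<open>The points of divergence lie in a null set \<open>N\<close>. Setting the function and
  all its approximants to 0 on \<open>N\<close> makes the convergence hold everywhere.\<close>

lemma simple_limit_representative:
  fixes f :: "'a \<Rightarrow> 'b::real_normed_vector"
  assumes "strongly_measurable M f"
  obtains g where "simple_limit M g" "AE x in M. f x = g x"
proof -
  obtain s where s: "\<And>i::nat. simple_function M (s i)" and lim: "AE x in M. (\<lambda>i. s i x) \<longlonglongrightarrow> f x"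
    using assms unfolding strongly_measurable_def by blast
  obtain N where N: "N \<in> null_sets M" "{x \<in> space M. \<not> (\<lambda>i. s i x) \<longlonglongrightarrow> f x} \<subseteq> N"
    using lim unfolding eventually_ae_filter by blast
  show ?thesis
  proof
    show "simple_limit M (\<lambda>x. indicator (space M - N) x *\<^sub>R f x)"
      unfolding simple_limit_def
    proof (intro exI conjI ballI allI)
      have "simple_function M (indicat_real (space M - N))"
        using N by (intro simple_function_indicator) auto
      then show "simple_function M (\<lambda>x. indicator (space M - N) x *\<^sub>R s i x)" for i
        using s by (intro simple_function_compose2[where h = "(*\<^sub>R)"])
      show "(\<lambda>i. indicator (space M - N) x *\<^sub>R s i x) \<longlonglongrightarrow> indicator (space M - N) x *\<^sub>R f x" if "x \<in> space M" for x
        using N that by (cases "x \<in> N") (auto simp: indicator_def)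
    qed
    show "AE x in M. f x = indicator (space M - N) x *\<^sub>R f x"
      using AE_not_in[OF N(1)] AE_space by eventually_elim (simp add: indicator_def)
  qed
qed

section \<open>Bochner integrals under null changes, restriction, norms and functionals\<close>

lemma bochner_has_integral_cong_AE:
  assumes "AE x in M. f x = g x"
  shows "bochner_has_integral M f I \<longleftrightarrow> bochner_has_integral M g I"
proof -
  have "strongly_measurable M f \<longleftrightarrow> strongly_measurable M g"
    unfolding strongly_measurable_def
  proof (intro iff_exI conj_cong refl)
    fix s show "(AE x in M. (\<lambda>i. s i x) \<longlonglongrightarrow> f x) \<longleftrightarrow> (AE x in M. (\<lambda>i::nat. s i x) \<longlonglongrightarrow> g x)"
      using assms by (intro iffI) (auto elim: AE_mp)
  qed
  moreover have "(\<integral>\<^sup>+x. ennreal (norm (f x - s x)) \<partial>M) = (\<integral>\<^sup>+x. ennreal (norm (g x - s x)) \<partial>M)" for s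
    using assms by (intro nn_integral_cong_AE) auto
  ultimately show ?thesis
    unfolding bochner_has_integral_def by simp
qed

text \<open>Restricting the approximants to \<open>A\<close> does not increase any \<open>L1\<close>
  distance, so their integrals are Cauchy and completeness supplies the value. Without such a value
  \<open>mean_on\<close>, which rests on a definite description, would be unspecified.\<close>

lemma bochner_integrable_indicator:
  fixes f :: "'a \<Rightarrow> 'b::banach"
  assumes f: "bochner_integrable M f" and A: "A \<in> sets M"
  shows "bochner_integrable M (\<lambda>x. indicator A x *\<^sub>R f x)"
proof -
  obtain s where sm: "strongly_measurable M f" and s: "\<And>i::nat. Bochner_Integration.simple_bochner_integrable M (s i)"
    and s0: "(\<lambda>i. \<integral>\<^sup>+x. ennreal (norm (f x - s i x)) \<partial>M) \<longlonglongrightarrow> 0"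
    using f unfolding bochner_integrable_def bochner_has_integral_def by blast
  let ?I = "Bochner_Integration.simple_bochner_integral M"
  define t where "t i x = indicator A x *\<^sub>R s i x" for i x
  have A': "simple_function M (indicat_real A)"
    using A by auto
  have sf: "simple_function M (s i)" for i
    using s by (auto elim: simple_bochner_integrable.cases)
  have tb: "Bochner_Integration.simple_bochner_integrable M (t i)" for i
  proof
    show "simple_function M (t i)"
      unfolding t_def by (rule simple_function_compose2[OF A' sf])
    have "emeasure M {y \<in> space M. t i y \<noteq> 0} \<le> emeasure M {y \<in> space M. s i y \<noteq> 0}"
      using simple_functionD(2)[OF sf[of i], of "- {0}"]
      by (intro emeasure_mono) (auto simp: t_def vimage_def Int_def conj_commute)
    also have "\<dots> < \<infinity>"
      using s[of i] by (auto elim!: simple_bochner_integrable.cases simp: less_top)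
    finally show "emeasure M {y \<in> space M. t i y \<noteq> 0} \<noteq> \<infinity>" by simp
  qed
  define e where "e i = (\<integral>\<^sup>+x. ennreal (norm (f x - s i x)) \<partial>M)" for i
  have le: "ennreal (norm (?I (t i) - ?I (t j))) \<le> e i + e j" for i j
  proof -
    have *: "Bochner_Integration.simple_bochner_integrable M (\<lambda>x. t i x - t j x)"
      using simple_bochner_integrable_compose2[of "(-)" M "t i" "t j"] tb by simp
    have "?I (t i) - ?I (t j) = ?I (\<lambda>x. t i x - t j x)"
      by (rule simple_bochner_integral_diff[OF tb tb, symmetric])
    then have "ennreal (norm (?I (t i) - ?I (t j))) \<le> (\<integral>\<^sup>+x. ennreal (norm (t i x - t j x)) \<partial>M)"
      using norm_simple_bochner_integral_le[OF *] by simp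
    also have "\<dots> \<le> (\<integral>\<^sup>+x. ennreal (norm (s i x - s j x)) \<partial>M)"
      by (intro nn_integral_mono) (auto simp: t_def indicator_def)
    also have "\<dots> \<le> e i + e j"
      unfolding e_def by (rule nn_integral_norm_triangle[OF sm sf sf])
    finally show ?thesis .
  qed
  have "Cauchy (\<lambda>i. ?I (t i))"
  proof (rule metric_CauchyI)
    fix \<epsilon> :: real assume "\<epsilon> > 0"
    then have "eventually (\<lambda>i. e i < ennreal (\<epsilon> / 2)) sequentially"
      using s0 unfolding e_def[symmetric] by (intro order_tendstoD) auto
    then obtain N where N: "\<And>i. i \<ge> N \<Longrightarrow> e i < ennreal (\<epsilon> / 2)"
      by (auto simp: eventually_sequentially)
    have "dist (?I (t i)) (?I (t j)) < \<epsilon>" if "i \<ge> N" "j \<ge> N" for i j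
    proof -
      have "ennreal (norm (?I (t i) - ?I (t j))) < ennreal (\<epsilon> / 2) + ennreal (\<epsilon> / 2)"
        using le[of i j] add_strict_mono[OF N[OF that(1)] N[OF that(2)]] by (rule le_less_trans)
      also have "\<dots> = ennreal \<epsilon>"
        using \<open>\<epsilon> > 0\<close> by (simp flip: ennreal_plus)
      finally show ?thesis by (simp add: dist_norm ennreal_less_iff)
    qed
    then show "\<exists>M. \<forall>m\<ge>M. \<forall>n\<ge>M. dist (?I (t m)) (?I (t n)) < \<epsilon>" by blast
  qed
  then obtain J where J: "(\<lambda>i. ?I (t i)) \<longlonglongrightarrow> J"
    using Cauchy_convergent_iff convergent_def by blast
  have "(\<lambda>i. \<integral>\<^sup>+x. ennreal (norm (indicator A x *\<^sub>R f x - t i x)) \<partial>M) \<longlonglongrightarrow> 0"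
  proof (rule tendsto_sandwich[OF always_eventually always_eventually tendsto_const s0]; intro allI)
    show "(\<integral>\<^sup>+x. ennreal (norm (indicator A x *\<^sub>R f x - t i x)) \<partial>M) \<le> (\<integral>\<^sup>+x. ennreal (norm (f x - s i x)) \<partial>M)" for i
      by (intro nn_integral_mono) (auto simp: t_def indicator_def)
  qed simp
  moreover have "strongly_measurable M (\<lambda>x. indicator A x *\<^sub>R f x)"
  proof -
    obtain u where u: "\<And>i::nat. simple_function M (u i)" "AE x in M. (\<lambda>i. u i x) \<longlonglongrightarrow> f x"
      using sm unfolding strongly_measurable_def by blast
    have "AE x in M. (\<lambda>i. indicator A x *\<^sub>R u i x) \<longlonglongrightarrow> indicator A x *\<^sub>R f x"
      using u(2) by eventually_elim (intro tendsto_intros)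
    moreover have "simple_function M (\<lambda>x. indicator A x *\<^sub>R u i x)" for i
      by (rule simple_function_compose2[OF A' u(1)])
    ultimately show ?thesis
      unfolding strongly_measurable_def by (intro exI[of _ "\<lambda>i x. indicator A x *\<^sub>R u i x"]) simp
  qed
  ultimately show ?thesis
    unfolding bochner_integrable_def bochner_has_integral_def using tb J by blast
qed

text \<open>Compared with a single simple approximant at \<open>L1\<close> distance below 1. The
  norm dominates \<open>x'(f)\<close> for all \<open>x'\<close> of the dual ball at once.\<close>

lemma bochner_integrable_norm:
  assumes "simple_limit M f" "bochner_integrable M f"
  shows "integrable M (\<lambda>x. norm (f x))"
proof (rule integrableI_bounded)
  show "(\<lambda>x. norm (f x)) \<in> borel_measurable M"
    by (intro simple_limit_borel_measurable simple_limit_compose[OF assms(1)] continuous_intros)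
  obtain s where s: "\<And>i::nat. Bochner_Integration.simple_bochner_integrable M (s i)"
    and s0: "(\<lambda>i. \<integral>\<^sup>+x. ennreal (norm (f x - s i x)) \<partial>M) \<longlonglongrightarrow> 0"
    using assms(2) unfolding bochner_integrable_def bochner_has_integral_def by blast
  have "eventually (\<lambda>i. (\<integral>\<^sup>+x. ennreal (norm (f x - s i x)) \<partial>M) < 1) sequentially"
    using s0 by (rule order_tendstoD) simp
  then obtain i where i: "(\<integral>\<^sup>+x. ennreal (norm (f x - s i x)) \<partial>M) < 1"
    by (auto simp: eventually_sequentially)
  have sf: "simple_limit M (s i)"
    using s by (auto elim: simple_bochner_integrable.cases intro: simple_limit_simple)
  have [measurable]: "(\<lambda>x. norm (f x - s i x)) \<in> borel_measurable M" "(\<lambda>x. norm (s i x)) \<in> borel_measurable M"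
    by (intro simple_limit_borel_measurable simple_limit_compose2[OF assms(1) sf, where h = "\<lambda>x y. norm (x - y)"]
        simple_limit_compose[OF sf];
        auto simp: split_def intro!: continuous_intros)+
  have "(\<integral>\<^sup>+x. ennreal (norm (norm (f x))) \<partial>M) \<le> (\<integral>\<^sup>+x. ennreal (norm (f x - s i x)) + ennreal (norm (s i x)) \<partial>M)"
    using norm_triangle_sub by (intro nn_integral_mono) (simp add: add.commute flip: ennreal_plus)
  also have "\<dots> = (\<integral>\<^sup>+x. ennreal (norm (f x - s i x)) \<partial>M) + (\<integral>\<^sup>+x. ennreal (norm (s i x)) \<partial>M)"
    by (rule nn_integral_add) auto
  also have "\<dots> < \<infinity>"
  proof -
    have *: "Bochner_Integration.simple_bochner_integrable M (\<lambda>x. norm (s i x))"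
      using simple_bochner_integrable_compose2[where p = "\<lambda>x y. norm x", OF _ s s] by simp
    have "(\<integral>\<^sup>+x. ennreal (norm (s i x)) \<partial>M) < \<infinity>"
      by (subst simple_bochner_integral_eq_nn_integral[OF *, symmetric]) auto
    then show ?thesis using i less_trans[OF i ennreal_one_less_top] by (auto simp: ennreal_add_eq_top less_top)
  qed
  finally show "(\<integral>\<^sup>+x. ennreal (norm (norm (f x))) \<partial>M) < \<infinity>" .
qed

text \<open>The images of the approximants under \<open>x'\<close> approximate \<open>x'(f)\<close>,
  with distances multiplied by at most \<open>norm x'\<close>. The conclusion is in terms of
  \<open>has_bochner_integral\<close>, so that the real-valued theory applies from here on.\<close>

lemma bochner_has_integral_blinfun:
  fixes x' :: "'b::real_normed_vector \<Rightarrow>\<^sub>L real"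
  assumes "simple_limit M f" "bochner_has_integral M f I"
  shows "has_bochner_integral M (\<lambda>x. blinfun_apply x' (f x)) (blinfun_apply x' I)"
proof -
  obtain s where s: "\<And>i::nat. Bochner_Integration.simple_bochner_integrable M (s i)"
    and s0: "(\<lambda>i. \<integral>\<^sup>+x. ennreal (norm (f x - s i x)) \<partial>M) \<longlonglongrightarrow> 0"
    and sI: "(\<lambda>i. Bochner_Integration.simple_bochner_integral M (s i)) \<longlonglongrightarrow> I"
    using assms(2) unfolding bochner_has_integral_def by blast
  have sf: "simple_limit M (s i)" for i
    using s by (auto elim: simple_bochner_integrable.cases intro: simple_limit_simple)
  have [measurable]: "(\<lambda>x. norm (f x - s i x)) \<in> borel_measurable M" for i
    by (intro simple_limit_borel_measurable simple_limit_compose2[OF assms(1) sf, where h = "\<lambda>x y. norm (x - y)"])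
       (auto simp: split_def intro!: continuous_intros)
  show ?thesis
  proof
    show "(\<lambda>x. blinfun_apply x' (f x)) \<in> borel_measurable M"
      by (intro simple_limit_borel_measurable simple_limit_compose[OF assms(1)] continuous_intros)
    show "Bochner_Integration.simple_bochner_integrable M (\<lambda>x. blinfun_apply x' (s i x))" for i
      using simple_bochner_integrable_compose2[where p = "\<lambda>x y. blinfun_apply x' x", OF _ s s] by simp
    have le: "(\<integral>\<^sup>+x. ennreal (norm (blinfun_apply x' (f x) - blinfun_apply x' (s i x))) \<partial>M)
       \<le> ennreal (norm x') * (\<integral>\<^sup>+x. ennreal (norm (f x - s i x)) \<partial>M)" for i
    proof -
      have "ennreal (norm (blinfun_apply x' (f x) - blinfun_apply x' (s i x))) \<le> ennreal (norm x') * ennreal (norm (f x - s i x))" for x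
        using norm_blinfun[of x' "f x - s i x"]
        by (simp add: blinfun.diff_right flip: ennreal_mult)
      then have "(\<integral>\<^sup>+x. ennreal (norm (blinfun_apply x' (f x) - blinfun_apply x' (s i x))) \<partial>M)
          \<le> (\<integral>\<^sup>+x. ennreal (norm x') * ennreal (norm (f x - s i x)) \<partial>M)"
        by (intro nn_integral_mono)
      then show ?thesis by (simp add: nn_integral_cmult)
    qed
    have "(\<lambda>i. ennreal (norm x') * (\<integral>\<^sup>+x. ennreal (norm (f x - s i x)) \<partial>M)) \<longlonglongrightarrow> ennreal (norm x') * 0"
      by (intro tendsto_mult_ennreal tendsto_const s0) auto
    then have lim0: "(\<lambda>i. ennreal (norm x') * (\<integral>\<^sup>+x. ennreal (norm (f x - s i x)) \<partial>M)) \<longlonglongrightarrow> 0" by simp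
    show "(\<lambda>i. \<integral>\<^sup>+x. ennreal (norm (blinfun_apply x' (f x) - blinfun_apply x' (s i x))) \<partial>M) \<longlonglongrightarrow> 0"
      by (rule tendsto_sandwich[OF always_eventually always_eventually tendsto_const lim0]) (simp_all only: le zero_le simp_thms)
    have "Bochner_Integration.simple_bochner_integral M (\<lambda>x. blinfun_apply x' (s i x))
        = blinfun_apply x' (Bochner_Integration.simple_bochner_integral M (s i))" for i
      using simple_bochner_integral_linear[OF bounded_linear.linear[OF blinfun.bounded_linear_right[of x']] s] .
    then show "(\<lambda>i. Bochner_Integration.simple_bochner_integral M (\<lambda>x. blinfun_apply x' (s i x))) \<longlonglongrightarrow> blinfun_apply x' I"
      using sI by (auto intro: tendsto_intros)
  qed
qed

section \<open>Oscillation and tails of real functions\<close>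

lemma mean_on_real:
  fixes g :: "'a \<Rightarrow> real"
  assumes "integrable M g" "A \<in> sets M"
  shows "mean_on M A g = (LINT x:A|M. g x) / measure M A"
proof -
  have "integrable M (\<lambda>x. indicator A x *\<^sub>R g x)"
    using assms by (intro integrable_mult_indicator)
  then show ?thesis
    by (simp add: mean_on_def bochner_integral_eq_lebesgue_integral set_lebesgue_integral_def)
qed

lemma (in finite_measure) bocce_osc_real:
  fixes g :: "'a \<Rightarrow> real"
  assumes g: "integrable M g" and A: "A \<in> sets M" "measure M A > 0"
  shows "bocce_osc M A g = ennreal ((LINT x:A|M. \<bar>g x - mean_on M A g\<bar>) / measure M A)"
proof -
  have "integrable M (\<lambda>x. indicator A x * \<bar>g x - mean_on M A g\<bar>)"
    using integrable_mult_indicator[OF A(1), of "\<lambda>x. \<bar>g x - mean_on M A g\<bar>"] g by simp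
  then have "(\<integral>\<^sup>+x\<in>A. ennreal (norm (g x - mean_on M A g)) \<partial>M) = ennreal (LINT x:A|M. \<bar>g x - mean_on M A g\<bar>)"
    unfolding set_lebesgue_integral_def
    by (subst nn_integral_eq_integral[symmetric])
       (auto intro!: nn_integral_cong simp: indicator_def)
  then show ?thesis
    using A by (simp add: bocce_osc_def emeasure_eq_measure divide_ennreal set_lebesgue_integral_def)
qed

lemma integrable_imp_set_integrable:
  fixes g :: "'a \<Rightarrow> real"
  shows "A \<in> sets M \<Longrightarrow> integrable M g \<Longrightarrow> set_integrable M A g"
  unfolding set_integrable_def by (rule integrable_mult_indicator)

lemma set_integral_null:
  fixes g :: "'a \<Rightarrow> real"
  assumes "A \<in> null_sets M"
  shows "(LINT x:A|M. g x) = 0"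
  unfolding set_lebesgue_integral_def
  using AE_not_in[OF assms] by (intro integral_eq_zero_AE) (auto simp: indicator_def)

text \<open>With the denominator cleared the bound also covers null sets, which the exhaustion may
  produce.\<close>

lemma (in finite_measure) bocce_osc_le_imp_set_integral_le:
  fixes g :: "'a \<Rightarrow> real"
  assumes g: "integrable M g" and A: "A \<in> sets M" and le: "bocce_osc M A g \<le> ennreal e" and "e \<ge> 0"
  shows "(LINT x:A|M. \<bar>g x - mean_on M A g\<bar>) \<le> e * measure M A"
proof (cases "measure M A = 0")
  case True
  then have "A \<in> null_sets M" using A by (simp add: emeasure_eq_measure null_setsI)
  with True show ?thesis by (simp add: set_integral_null)
next
  case False
  then have "measure M A > 0" by (simp add: order_le_neq_trans)
  with le \<open>e \<ge> 0\<close> show ?thesis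
    by (simp add: bocce_osc_real[OF g A] pos_divide_le_eq)
qed

lemma (in finite_measure) set_integral_eq_measure_mean:
  fixes g :: "'a \<Rightarrow> real"
  assumes g: "integrable M g" and A: "A \<in> sets M"
  shows "(LINT x:A|M. g x) = measure M A * mean_on M A g"
proof (cases "measure M A = 0")
  case True
  then have "A \<in> null_sets M" using A by (simp add: emeasure_eq_measure null_setsI)
  with True show ?thesis by (simp add: set_integral_null)
qed (simp add: mean_on_real[OF assms])

lemma (in finite_measure) set_integral_const_real:
  assumes "A \<in> sets M"
  shows "(LINT x:A|M. (c :: real)) = measure M A * c"
  using assms by (simp add: set_lebesgue_integral_def)

text \<open>The mean is no farther from \<open>c\<close> than \<open>g\<close> is on average, whence
  the factor 2. Oscillation can thus be estimated with any convenient constant in place of the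
  mean.\<close>

lemma (in finite_measure) set_integral_abs_diff_mean_le:
  fixes g :: "'a \<Rightarrow> real"
  assumes g: "integrable M g" and A: "A \<in> sets M"
  shows "(LINT x:A|M. \<bar>g x - mean_on M A g\<bar>) \<le> 2 * (LINT x:A|M. \<bar>g x - c\<bar>)"
proof -
  note si = integrable_imp_set_integrable
  have gA: "set_integrable M A g" and cA: "set_integrable M A (\<lambda>_. c)"
    using g A by (auto intro!: si)
  have "measure M A * \<bar>c - mean_on M A g\<bar> = \<bar>LINT x:A|M. g x - c\<bar>"
    using set_integral_diff(2)[OF gA cA] set_integral_eq_measure_mean[OF g A] set_integral_const_real[OF A, of c]
    by (simp add: abs_mult abs_minus_commute flip: right_diff_distrib)
  also have "\<dots> \<le> (LINT x:A|M. \<bar>g x - c\<bar>)"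
    using set_integral_norm_bound[OF set_integral_diff(1)[OF gA cA]] by simp
  finally have *: "measure M A * \<bar>c - mean_on M A g\<bar> \<le> (LINT x:A|M. \<bar>g x - c\<bar>)" .
  have "(LINT x:A|M. \<bar>g x - mean_on M A g\<bar>) \<le> (LINT x:A|M. \<bar>g x - c\<bar> + \<bar>c - mean_on M A g\<bar>)"
    using g A by (intro set_integral_mono si) auto
  also have "\<dots> = (LINT x:A|M. \<bar>g x - c\<bar>) + measure M A * \<bar>c - mean_on M A g\<bar>"
    using g A by (subst set_integral_add(2)) (auto intro!: si simp: set_integral_const_real)
  finally show ?thesis using * by simp
qed

text \<open>Weak lower semicontinuity of the \<open>L\<^sup>1\<close> distance to a constant: test against the two sets on
  which the limit function lies above, respectively below, the constant.\<close>

lemma (in finite_measure) set_integral_abs_diff_le_of_tendsto: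
  fixes g :: "nat \<Rightarrow> 'a \<Rightarrow> real"
  assumes g: "\<And>j. integrable M (g j)" and g0: "integrable M g0"
    and lim: "\<And>B. B \<in> sets M \<Longrightarrow> (\<lambda>j. LINT x:B|M. g j x) \<longlonglongrightarrow> (LINT x:B|M. g0 x)"
    and c: "c \<longlonglongrightarrow> c0" and A: "A \<in> sets M"
    and le: "eventually (\<lambda>j. (LINT x:A|M. \<bar>g j x - c j\<bar>) \<le> C) sequentially"
  shows "(LINT x:A|M. \<bar>g0 x - c0\<bar>) \<le> C"
proof -
  note [measurable] = borel_measurable_integrable[OF g0] A
  define P where "P = {x \<in> A. c0 \<le> g0 x}"
  define Q where "Q = {x \<in> A. \<not> c0 \<le> g0 x}"
  have "P = {x \<in> space M. x \<in> A \<and> c0 \<le> g0 x}" "Q = {x \<in> space M. x \<in> A \<and> \<not> c0 \<le> g0 x}"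
    using sets.sets_into_space[OF A] by (auto simp: P_def Q_def)
  then have [measurable]: "P \<in> sets M" "Q \<in> sets M" by simp_all
  have i: "integrable M (\<lambda>x. indicator P x *\<^sub>R (h x - d))" "integrable M (\<lambda>x. indicator Q x *\<^sub>R (h x - d))"
    if "integrable M h" for h :: "'a \<Rightarrow> real" and d
    using that by (auto intro!: integrable_mult_indicator simp del: real_scaleR_def)
  have PQ: "A = P \<union> Q" "P \<inter> Q = {}" by (auto simp: P_def Q_def)
  note si = integrable_imp_set_integrable
  have diff: "(LINT x:B|M. h x - d) = (LINT x:B|M. h x) - measure M B * d"
    if "B \<in> sets M" "integrable M h" for B d and h :: "'a \<Rightarrow> real"
    using that by (simp add: set_integral_diff si set_integral_const_real)
  \<comment> \<open>\<open>T\<close> integrates against the sign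
    \<open>indicator P - indicator Q\<close> fixed by the limit. It is below the \<open>L1\<close>
    distance for every function, attains it at \<open>g0\<close> and \<open>c0\<close>, and passes
    to the limit since \<open>P\<close> and \<open>Q\<close> do not vary with
    \<open>j\<close>.\<close>
  define T where "T h d = (LINT x:P|M. h x - d) - (LINT x:Q|M. h x - d)" for h :: "'a \<Rightarrow> real" and d
  have T_le: "T h d \<le> (LINT x:A|M. \<bar>h x - d\<bar>)" if h: "integrable M h" for h :: "'a \<Rightarrow> real" and d
  proof -
    have "T h d = (LINT x:A|M. (indicator P x - indicator Q x) * (h x - d))"
      unfolding T_def set_lebesgue_integral_def Bochner_Integration.integral_diff[OF i[OF h], symmetric]
      using PQ(2) by (intro Bochner_Integration.integral_cong) (auto simp: PQ(1) indicator_def)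
    also have "\<dots> \<le> (LINT x:A|M. \<bar>h x - d\<bar>)"
      unfolding set_lebesgue_integral_def
    proof (intro integral_mono)
      show "integrable M (\<lambda>x. indicat_real A x *\<^sub>R ((indicat_real P x - indicat_real Q x) * (h x - d)))"
        by (rule Bochner_Integration.integrable_bound[where f = "\<lambda>x. h x - d"])
           (use h in \<open>auto simp: PQ indicator_def\<close>)
      show "integrable M (\<lambda>x. indicat_real A x *\<^sub>R \<bar>h x - d\<bar>)"
        using h A by (intro integrable_mult_indicator) auto
    qed (auto simp: PQ indicator_def)
    finally show ?thesis .
  qed
  have "(LINT x:A|M. \<bar>g0 x - c0\<bar>) = T g0 c0"
    unfolding T_def set_lebesgue_integral_def Bochner_Integration.integral_diff[OF i[OF g0], symmetric]
    by (intro Bochner_Integration.integral_cong) (auto simp: P_def Q_def indicator_def)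
  moreover have "(\<lambda>j. T (g j) (c j)) \<longlonglongrightarrow> T g0 c0"
    unfolding T_def using g g0 by (simp add: diff) (intro tendsto_intros lim c; simp)
  moreover have "eventually (\<lambda>j. T (g j) (c j) \<le> C) sequentially"
    using le by eventually_elim (use T_le[OF g] in \<open>rule order_trans\<close>)
  ultimately show ?thesis
    using tendsto_upperbound by fastforce
qed

text \<open>On each \<open>A n\<close> the triangle inequality goes through both means; on the
  uncovered set the two functions are estimated separately, without cancellation.\<close>

lemma (in finite_measure) integral_abs_diff_le_partition:
  fixes g g0 :: "'a \<Rightarrow> real" and A :: "nat \<Rightarrow> 'a set"
  assumes g: "integrable M g" and g0: "integrable M g0"
    and A: "\<And>n. A n \<in> sets M" "disjoint_family A"
  shows "(\<integral>x. \<bar>g x - g0 x\<bar> \<partial>M) \<le>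
    (\<Sum>n<N. (LINT x:A n|M. \<bar>g x - mean_on M (A n) g\<bar>) + (LINT x:A n|M. \<bar>g0 x - mean_on M (A n) g0\<bar>)
        + measure M (A n) * \<bar>mean_on M (A n) g - mean_on M (A n) g0\<bar>)
    + ((LINT x:space M - (\<Union>n<N. A n)|M. \<bar>g x\<bar>) + (LINT x:space M - (\<Union>n<N. A n)|M. \<bar>g0 x\<bar>))"
proof -
  let ?R = "space M - (\<Union>n<N. A n)"
  have R: "?R \<in> sets M" using A by auto
  note si = integrable_imp_set_integrable
  have U: "set_integrable M (\<Union>n<N. A n) (\<lambda>x. \<bar>g x - g0 x\<bar>)"
    using A g g0 by (intro si) auto
  have "(\<integral>x. \<bar>g x - g0 x\<bar> \<partial>M) = (LINT x:(\<Union>n<N. A n) \<union> ?R|M. \<bar>g x - g0 x\<bar>)"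
    unfolding set_lebesgue_integral_def by (intro Bochner_Integration.integral_cong) auto
  also have "\<dots> = (LINT x:(\<Union>n<N. A n)|M. \<bar>g x - g0 x\<bar>) + (LINT x:?R|M. \<bar>g x - g0 x\<bar>)"
    using R g g0 by (intro set_integral_Un U si) auto
  also have "(LINT x:(\<Union>n<N. A n)|M. \<bar>g x - g0 x\<bar>) = (\<Sum>n<N. LINT x:A n|M. \<bar>g x - g0 x\<bar>)"
    using A g g0 by (intro set_integral_finite_Union si) (auto intro: disjoint_family_on_mono)
  also have "(\<Sum>n<N. LINT x:A n|M. \<bar>g x - g0 x\<bar>) \<le>
    (\<Sum>n<N. (LINT x:A n|M. \<bar>g x - mean_on M (A n) g\<bar>) + (LINT x:A n|M. \<bar>g0 x - mean_on M (A n) g0\<bar>)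
        + measure M (A n) * \<bar>mean_on M (A n) g - mean_on M (A n) g0\<bar>)"
  proof (rule sum_mono)
    fix n
    let ?a = "mean_on M (A n) g" and ?b = "mean_on M (A n) g0"
    have "(LINT x:A n|M. \<bar>g x - g0 x\<bar>) \<le> (LINT x:A n|M. (\<bar>g x - ?a\<bar> + \<bar>g0 x - ?b\<bar>) + \<bar>?a - ?b\<bar>)"
      using A g g0 by (intro set_integral_mono si) auto
    also have "\<dots> = (LINT x:A n|M. \<bar>g x - ?a\<bar>) + (LINT x:A n|M. \<bar>g0 x - ?b\<bar>) + measure M (A n) * \<bar>?a - ?b\<bar>"
      using A g g0 by (subst set_integral_add; (intro si)?) (auto simp: set_integral_const_real intro!: set_integral_add(2) si)
    finally show "(LINT x:A n|M. \<bar>g x - g0 x\<bar>) \<le> \<dots>" .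
  qed
  also have "(LINT x:?R|M. \<bar>g x - g0 x\<bar>) \<le> (LINT x:?R|M. \<bar>g x\<bar> + \<bar>g0 x\<bar>)"
    using R g g0 by (intro set_integral_mono si) auto
  also have "\<dots> = (LINT x:?R|M. \<bar>g x\<bar>) + (LINT x:?R|M. \<bar>g0 x\<bar>)"
    using R g g0 by (intro set_integral_add si) auto
  finally show ?thesis by simp
qed

section \<open>Tail integrals and uniform integrability\<close>

lemma tail_integral_tendsto_0:
  fixes h :: "'a \<Rightarrow> real"
  assumes h: "integrable M h"
  shows "((\<lambda>c. \<integral>\<^sup>+x\<in>{x. \<bar>h x\<bar> \<ge> c}. ennreal \<bar>h x\<bar> \<partial>M) \<longlongrightarrow> 0) at_top"
proof -
  note [measurable] = borel_measurable_integrable[OF h]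
  have eq: "(\<integral>\<^sup>+x\<in>{x. \<bar>h x\<bar> \<ge> c}. ennreal \<bar>h x\<bar> \<partial>M) = ennreal (\<integral>x. indicator {x. \<bar>h x\<bar> \<ge> c} x * \<bar>h x\<bar> \<partial>M)" for c
  proof (subst nn_integral_eq_integral[symmetric])
    show "integrable M (\<lambda>x. indicat_real {x. \<bar>h x\<bar> \<ge> c} x * \<bar>h x\<bar>)"
      by (rule Bochner_Integration.integrable_bound[OF h]) (auto simp: indicator_def)
  qed (auto intro!: nn_integral_cong simp: indicator_def)
  have "((\<lambda>c. \<integral>x. indicator {x. \<bar>h x\<bar> \<ge> c} x * \<bar>h x\<bar> \<partial>M) \<longlongrightarrow> (\<integral>x. 0 \<partial>M)) at_top"
  proof (rule integral_dominated_convergence_at_top)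
    show "integrable M (\<lambda>x. \<bar>h x\<bar>)" using h by simp
    show "AE x in M. ((\<lambda>c. indicat_real {x. \<bar>h x\<bar> \<ge> c} x * \<bar>h x\<bar>) \<longlongrightarrow> 0) at_top"
    proof (intro AE_I2 tendsto_eventually)
      show "eventually (\<lambda>c. indicat_real {x. \<bar>h x\<bar> \<ge> c} x * \<bar>h x\<bar> = 0) at_top" for x
        using eventually_gt_at_top[of "\<bar>h x\<bar>"] by eventually_elim (simp add: indicator_def)
    qed
  qed (auto simp: indicator_def intro!: always_eventually)
  from tendsto_ennrealI[OF this] show ?thesis
    unfolding eq by simp
qed

text \<open>If \<open>|h x| \<ge> c\<close> while \<open>|g x| < c / 2\<close>, then \<open>|h x| \<le> 2 * |h x - g x|\<close>.\<close>

lemma tail_integral_le: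
  fixes g h :: "'a \<Rightarrow> real"
  assumes [measurable]: "g \<in> borel_measurable M" "h \<in> borel_measurable M" "w \<in> borel_measurable M"
    and w: "\<And>x. \<bar>g x\<bar> \<le> w x"
  shows "(\<integral>\<^sup>+x\<in>{x. \<bar>h x\<bar> \<ge> c}. ennreal \<bar>h x\<bar> \<partial>M) \<le>
    2 * (\<integral>\<^sup>+x. ennreal \<bar>h x - g x\<bar> \<partial>M) + 2 * (\<integral>\<^sup>+x\<in>{x. \<bar>w x\<bar> \<ge> c / 2}. ennreal \<bar>w x\<bar> \<partial>M)"
proof -
  have "(\<integral>\<^sup>+x\<in>{x. \<bar>h x\<bar> \<ge> c}. ennreal \<bar>h x\<bar> \<partial>M) \<le>
    (\<integral>\<^sup>+x. 2 * ennreal \<bar>h x - g x\<bar> + 2 * (ennreal \<bar>w x\<bar> * indicator {x. \<bar>w x\<bar> \<ge> c / 2} x) \<partial>M)"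
  proof (rule nn_integral_mono)
    fix x
    \<comment> \<open>In the remaining case \<open>\<bar>w x\<bar> \<ge> c / 2\<close>, the estimate
      is \<open>\<bar>h x\<bar> \<le> \<bar>h x - g x\<bar> + w x\<close>.\<close>
    have "\<bar>h x\<bar> * indicator {x. \<bar>h x\<bar> \<ge> c} x \<le> 2 * \<bar>h x - g x\<bar> + 2 * (\<bar>w x\<bar> * indicator {x. \<bar>w x\<bar> \<ge> c / 2} x)"
      using w[of x] by (auto simp: indicator_def split: if_splits) (simp_all add: abs_if split: if_splits)
    then have "ennreal (\<bar>h x\<bar> * indicator {x. \<bar>h x\<bar> \<ge> c} x) \<le> ennreal (2 * \<bar>h x - g x\<bar> + 2 * (\<bar>w x\<bar> * indicator {x. \<bar>w x\<bar> \<ge> c / 2} x))"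
      by (rule ennreal_leI)
    then show "ennreal \<bar>h x\<bar> * indicator {x. \<bar>h x\<bar> \<ge> c} x \<le> 2 * ennreal \<bar>h x - g x\<bar> + 2 * (ennreal \<bar>w x\<bar> * indicator {x. \<bar>w x\<bar> \<ge> c / 2} x)"
      by (simp add: ennreal_mult ennreal_indicator)
  qed
  also have "\<dots> = 2 * (\<integral>\<^sup>+x. ennreal \<bar>h x - g x\<bar> \<partial>M) + 2 * (\<integral>\<^sup>+x\<in>{x. \<bar>w x\<bar> \<ge> c / 2}. ennreal \<bar>w x\<bar> \<partial>M)"
    by (subst nn_integral_add) (auto simp: nn_integral_cmult)
  finally show ?thesis .
qed

text \<open>On \<open>A\<close>, the function is at most \<open>c\<close> outside its tail. A common
  tail bound therefore gives uniformly small integrals over sets of small measure.\<close>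

lemma (in finite_measure) set_integral_abs_le_tail:
  fixes h :: "'a \<Rightarrow> real"
  assumes h: "integrable M h" and A: "A \<in> sets M" and "c \<ge> 0"
    and le: "(\<integral>\<^sup>+x\<in>{x. \<bar>h x\<bar> \<ge> c}. ennreal \<bar>h x\<bar> \<partial>M) \<le> ennreal e" and "e \<ge> 0"
  shows "(LINT x:A|M. \<bar>h x\<bar>) \<le> e + c * measure M A"
proof -
  note [measurable] = borel_measurable_integrable[OF h] A
  have "ennreal (LINT x:A|M. \<bar>h x\<bar>) = (\<integral>\<^sup>+x. ennreal \<bar>h x\<bar> * indicator A x \<partial>M)"
    unfolding set_lebesgue_integral_def using integrable_mult_indicator[OF A integrable_abs[OF h]]
    by (subst nn_integral_eq_integral[symmetric]) (auto intro!: nn_integral_cong simp: indicator_def)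
  also have "\<dots> \<le> (\<integral>\<^sup>+x. ennreal \<bar>h x\<bar> * indicator {x. \<bar>h x\<bar> \<ge> c} x + ennreal c * indicator A x \<partial>M)"
    using \<open>c \<ge> 0\<close> by (intro nn_integral_mono) (auto simp: indicator_def intro!: ennreal_leI)
  also have "\<dots> = (\<integral>\<^sup>+x\<in>{x. \<bar>h x\<bar> \<ge> c}. ennreal \<bar>h x\<bar> \<partial>M) + ennreal c * emeasure M A"
    by (subst nn_integral_add) (auto simp: nn_integral_cmult_indicator)
  also have "\<dots> \<le> ennreal e + ennreal c * emeasure M A"
    using le by (rule add_right_mono)
  also have "\<dots> = ennreal (e + c * measure M A)"
    using \<open>c \<ge> 0\<close> \<open>e \<ge> 0\<close> by (simp add: emeasure_eq_measure ennreal_mult)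
  finally show ?thesis
    using \<open>c \<ge> 0\<close> \<open>e \<ge> 0\<close> by (simp del: ennreal_plus)
qed

section \<open>Exhaustion by sets of small oscillation\<close>

text \<open>Greedy exhaustion: \<open>A n\<close> has at least half the measure of any set disjoint from its predecessors
  that satisfies \<open>Q\<close> for infinitely many of the indices retained so far. A nonnull remainder would
  contain a set admissible at every stage, although the measures of the \<open>A n\<close> tend to \<open>0\<close>.\<close>

lemma (in finite_measure) exhaustion_diagonal:
  fixes Q :: "'a set \<Rightarrow> nat \<Rightarrow> bool"
  assumes Q0: "\<And>k. Q {} k"
    and ex: "\<And>S B. infinite S \<Longrightarrow> B \<in> pos_sets M \<Longrightarrow>
      \<exists>A\<in>pos_sets M. A \<subseteq> B \<and> infinite {k \<in> S. Q A k}"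
    and S0: "infinite S0"
  obtains A :: "nat \<Rightarrow> 'a set" and d :: "nat \<Rightarrow> nat" where "range A \<subseteq> sets M" "disjoint_family A" "strict_mono d" "\<And>j. d j \<in> S0"
    "\<And>n j. n \<le> j \<Longrightarrow> Q (A n) (d j)" "measure M (space M - (\<Union>n. A n)) = 0"
proof -
  \<comment> \<open>\<open>S\<close> stands for the indices still retained, \<open>C\<close> for the
    part already covered.\<close>
  define adm where "adm S C A \<longleftrightarrow> A \<in> sets M \<and> A \<inter> C = {} \<and> infinite {k \<in> S. Q A k}" for S C A
  \<comment> \<open>The supremum of the admissible measures need not be attained; the factor 2
    leaves room for a near-maximal choice.\<close>
  define opt where "opt S C A \<longleftrightarrow> adm S C A \<and> (\<forall>A'. adm S C A' \<longrightarrow> measure M A' \<le> 2 * measure M A)" for S C A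
  have opt_ex: "\<exists>A. opt S C A" if S: "infinite S" for S C
  proof -
    let ?X = "measure M ` {A. adm S C A}"
    \<comment> \<open>The empty set is always admissible, so the construction never gets
      stuck.\<close>
    have e: "adm S C {}" using S Q0 by (simp add: adm_def)
    have bdd: "bdd_above ?X"
      by (intro bdd_aboveI[of _ "measure M (space M)"]) (auto intro: bounded_measure)
    show ?thesis
    proof (cases "Sup ?X \<le> 0")
      case True
      then have "measure M A' \<le> 0" if "adm S C A'" for A'
        using cSup_upper[OF _ bdd, of "measure M A'"] that by fastforce
      then show ?thesis using e unfolding opt_def by (intro exI[of _ "{}"]) auto
    next
      case False
      then have "Sup ?X / 2 < Sup ?X" by simp
      then obtain A where A: "adm S C A" "Sup ?X / 2 < measure M A"
        using less_cSup_iff[OF _ bdd, of "Sup ?X / 2"] e by auto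
      have "measure M A' \<le> Sup ?X" if "adm S C A'" for A'
        using cSup_upper[OF _ bdd, of "measure M A'"] that by fastforce
      with A show ?thesis unfolding opt_def by fastforce
    qed
  qed
  define step where "step s t \<longleftrightarrow> (case (s, t) of ((S, C, A), (S', C', A')) \<Rightarrow>
    opt S C A' \<and> S' = {k \<in> S. Q A' k} \<and> C' = C \<union> A')" for s t :: "nat set \<times> 'a set \<times> 'a set"
  have "\<exists>st. \<forall>n. (infinite (fst (st n)) \<and> (n = 0 \<longrightarrow> st n = (S0, {}, {}))) \<and> step (st n) (st (Suc n))"
  proof (rule dependent_nat_choice)
    show "\<exists>x. infinite (fst x) \<and> (0 = (0::nat) \<longrightarrow> x = (S0, {}, {}))" using S0 by auto
    fix x :: "nat set \<times> 'a set \<times> 'a set" and n :: nat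
    assume "infinite (fst x) \<and> (n = 0 \<longrightarrow> x = (S0, {}, {}))"
    then show "\<exists>y. (infinite (fst y) \<and> (Suc n = 0 \<longrightarrow> y = (S0, {}, {}))) \<and> step x y"
      using opt_ex[of "fst x" "fst (snd x)"] by (cases x) (auto simp: step_def opt_def adm_def)
  qed
  then obtain st where st: "\<And>n. infinite (fst (st n))" "st 0 = (S0, {}, {})" "\<And>n. step (st n) (st (Suc n))"
    by blast
  define S C A where "S n = fst (st n)" and "C n = fst (snd (st n))" and "A n = snd (snd (st (Suc n)))" for n
  have S: "infinite (S n)" "S 0 = S0" and C0: "C 0 = {}" for n
    using st by (auto simp: S_def C_def)
  have opt: "opt (S n) (C n) (A n)" and SS: "S (Suc n) = {k \<in> S n. Q (A n) k}" and CS: "C (Suc n) = C n \<union> A n" for n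
    using st(3)[of n] by (auto simp: step_def S_def C_def A_def split: prod.splits)
  have adm: "adm (S n) (C n) (A n)" for n using opt by (simp add: opt_def)
  have C: "C n = (\<Union>i<n. A i)" for n
    by (induction n) (auto simp: C0 CS lessThan_Suc)
  have "decseq S" using SS by (intro decseq_SucI) auto
  then have Sm: "S n \<subseteq> S m" if "m \<le> n" for m n using that by (auto simp: decseq_def)
  have A: "range A \<subseteq> sets M" using adm by (auto simp: adm_def)
  have "A m \<inter> A n = {}" if "m < n" for m n
    using adm[of n] that by (auto simp: adm_def C)
  then have disj: "disjoint_family A"
    unfolding disjoint_family_on_def by (metis Int_commute linorder_neqE_nat)
  have unb: "\<exists>k\<in>S n. m < k" for n m
    using S(1)[of n] by (meson infinite_nat_iff_unbounded)
  \<comment> \<open>\<open>S (Suc n)\<close> is already thinned for \<open>A n\<close>, so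
    \<open>d n\<close> itself is good for \<open>A n\<close> and the final estimate starts at
    \<open>j = n\<close>.\<close>
  have "\<exists>d. \<forall>n. d n \<in> S (Suc n) \<and> d n < d (Suc n)"
    by (rule dependent_nat_choice) (use unb in blast)+
  then obtain d where d: "\<And>n. d n \<in> S (Suc n)" "\<And>n. d n < d (Suc n)" by blast
  have dm: "strict_mono d" using d(2) by (simp add: strict_mono_Suc_iff)
  have null: "measure M (space M - (\<Union>n. A n)) = 0"
  proof (rule ccontr)
    assume "measure M (space M - (\<Union>n. A n)) \<noteq> 0"
    then have "space M - (\<Union>n. A n) \<in> pos_sets M"
      using A by (auto simp: pos_sets_def zero_less_measure_iff)
    \<comment> \<open>Applying \<open>ex\<close> to the diagonal indices, rather than to some
      \<open>S n\<close>, gives one set that can be compared with the choice at every stage.\<close>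
    moreover have "infinite (range d)" using dm by (simp add: strict_mono_imp_inj_on range_inj_infinite)
    ultimately obtain A' where A': "A' \<in> pos_sets M" "A' \<subseteq> space M - (\<Union>n. A n)" "infinite {k \<in> range d. Q A' k}"
      using ex by blast
    have "measure M A' \<le> 2 * measure M (A n)" for n
    proof -
      \<comment> \<open>All but finitely many diagonal indices lie in \<open>S n\<close>, so
        removing the first \<open>n\<close> keeps the good ones infinite in number.\<close>
      have "{k \<in> range d. Q A' k} - d ` {..<n} \<subseteq> {k \<in> S n. Q A' k}"
      proof safe
        fix j assume "Q A' (d j)" "d j \<notin> d ` {..<n}"
        then have "n \<le> Suc j" by (cases "j < n") auto
        then show "d j \<in> S n" using d(1)[of j] Sm by blast
      qed
      then have "infinite {k \<in> S n. Q A' k}"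
        using A'(3) by (meson finite_imageI finite_lessThan infinite_super Diff_infinite_finite)
      then have "adm (S n) (C n) A'"
        using A' by (auto simp: adm_def C pos_sets_def)
      then show ?thesis using opt by (auto simp: opt_def)
    qed
    \<comment> \<open>Disjoint sets in a finite measure space have summable measures.\<close>
    moreover have "(\<lambda>n. 2 * measure M (A n)) \<longlonglongrightarrow> 2 * 0"
      by (intro tendsto_intros summable_LIMSEQ_zero sums_summable[OF finite_measure_UNION[OF A disj]])
    ultimately have "measure M A' \<le> 2 * 0" using LIMSEQ_le_const by blast
    then show False using A'(1) by (simp add: pos_sets_def)
  qed
  have dS0: "d j \<in> S0" for j using d(1)[of j] Sm[of 0 "Suc j"] S(2) by auto
  have QA: "Q (A n) (d j)" if "n \<le> j" for n j
    using d(1)[of j] Sm[of "Suc n" "Suc j"] that SS by auto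
  show ?thesis by (rule that[OF A disj dm dS0 QA null])
qed

lemma tendsto_0_ennrealI:
  fixes F :: "'a \<Rightarrow> ennreal"
  assumes "\<And>e. e > 0 \<Longrightarrow> eventually (\<lambda>x. F x \<le> ennreal e) net"
  shows "(F \<longlongrightarrow> 0) net"
proof (rule order_tendstoI)
  fix a :: ennreal assume "0 < a"
  then obtain b where b: "0 < b" "b < a" using dense by blast
  then obtain e where "b = ennreal e" "e > 0"
    by (cases b) (auto simp: ennreal_less_zero_iff)
  then show "eventually (\<lambda>x. F x < a) net"
    using assms[of e] b by (auto elim: eventually_mono)
qed simp

section \<open>Invariance under changes on null sets\<close>

lemma bochner_integrable_cong_AE:
  "AE x in M. f x = g x \<Longrightarrow> bochner_integrable M f \<longleftrightarrow> bochner_integrable M g"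
  unfolding bochner_integrable_def using bochner_has_integral_cong_AE by metis

lemma mean_on_cong_AE:
  assumes "AE x in M. f x = g x"
  shows "mean_on M A f = mean_on M A g"
proof -
  have "AE x in M. indicator A x *\<^sub>R f x = indicator A x *\<^sub>R g x"
    using assms by eventually_elim simp
  then have "bochner_has_integral M (\<lambda>x. indicator A x *\<^sub>R f x) = bochner_has_integral M (\<lambda>x. indicator A x *\<^sub>R g x)"
    by (intro ext bochner_has_integral_cong_AE)
  then show ?thesis
    by (simp only: mean_on_def bochner_integral_def)
qed

lemma pettis_bocce_osc_cong_AE:
  fixes f g :: "'a \<Rightarrow> 'b::real_normed_vector"
  assumes "AE x in M. f x = g x"
  shows "pettis_bocce_osc M A f = pettis_bocce_osc M A g"
proof -
  have "bocce_osc M A (\<lambda>x. blinfun_apply x' (f x)) = bocce_osc M A (\<lambda>x. blinfun_apply x' (g x))" for x' :: "'b \<Rightarrow>\<^sub>L real"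
  proof -
    have *: "AE x in M. blinfun_apply x' (f x) = blinfun_apply x' (g x)"
      using assms by eventually_elim simp
    show ?thesis
      unfolding bocce_osc_def mean_on_cong_AE[OF *]
      using * by (intro arg_cong2[where f = "(/)"] nn_integral_cong_AE refl) auto
  qed
  then show ?thesis by (simp add: pettis_bocce_osc_def)
qed

lemma pettis_norm_cong_AE:
  assumes "AE x in M. f x = g x"
  shows "pettis_norm M f = pettis_norm M g"
  unfolding pettis_norm_def using assms by (intro SUP_cong refl nn_integral_cong_AE) auto

lemma pettis_uniformly_integrable_cong_AE:
  fixes f g :: "nat \<Rightarrow> 'a \<Rightarrow> 'b::real_normed_vector"
  assumes "\<And>k. AE x in M. f k x = g k x"
  shows "pettis_uniformly_integrable M (range f) \<longleftrightarrow> pettis_uniformly_integrable M (range g)"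
proof -
  \<comment> \<open>Changing functions on null sets changes the family as a set, so both families
    are indexed by the pairs \<open>(x', k)\<close> and their tails compared pair by pair.\<close>
  have *: "{(\<lambda>x. blinfun_apply x' (h x)) | x' h. x' \<in> cball (0 :: 'b \<Rightarrow>\<^sub>L real) 1 \<and> h \<in> range F}
      = (\<lambda>(x', k) x. blinfun_apply x' (F k x)) ` (cball 0 1 \<times> UNIV)" for F :: "nat \<Rightarrow> 'a \<Rightarrow> 'b"
    by (auto simp: image_iff Bex_def) blast+
  have "(\<integral>\<^sup>+x\<in>{x. c \<le> \<bar>blinfun_apply x' (f k x)\<bar>}. ennreal \<bar>blinfun_apply x' (f k x)\<bar> \<partial>M)
      = (\<integral>\<^sup>+x\<in>{x. c \<le> \<bar>blinfun_apply x' (g k x)\<bar>}. ennreal \<bar>blinfun_apply x' (g k x)\<bar> \<partial>M)" for c k and x' :: "'b \<Rightarrow>\<^sub>L real"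
    using assms[of k] by (intro nn_integral_cong_AE) (auto simp: indicator_def)
  then show ?thesis
    unfolding pettis_uniformly_integrable_def uniformly_integrable_def * image_image
    by (simp add: case_prod_unfold)
qed

section \<open>Scalar averages of vector functions\<close>

lemma abs_blinfun_le_norm:
  fixes x' :: "'b::real_normed_vector \<Rightarrow>\<^sub>L real"
  assumes "norm x' \<le> 1"
  shows "\<bar>blinfun_apply x' v\<bar> \<le> norm v"
  using norm_blinfun[of x' v] mult_right_mono[OF assms norm_ge_zero[of v]] by simp

lemma integrable_blinfun:
  fixes x' :: "'b::real_normed_vector \<Rightarrow>\<^sub>L real"
  assumes "simple_limit M f" "bochner_integrable M f"
  shows "integrable M (\<lambda>x. blinfun_apply x' (f x))"
  using assms bochner_has_integral_blinfun
  unfolding bochner_integrable_def Bochner_Integration.integrable.simps by metis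

text \<open>The integral over \<open>A\<close> exists by completeness of the value space, and
  \<open>x'\<close> commutes with it.\<close>

lemma mean_on_blinfun:
  fixes x' :: "'b::banach \<Rightarrow>\<^sub>L real"
  assumes f: "simple_limit M f" "bochner_integrable M f" and A: "A \<in> sets M"
  shows "mean_on M A (\<lambda>x. blinfun_apply x' (f x)) = blinfun_apply x' (mean_on M A f)"
proof -
  have "simple_limit M (\<lambda>x. indicat_real A x *\<^sub>R f x)"
    using A by (intro simple_limit_compose2[where h = "(*\<^sub>R)"] f simple_limit_simple simple_function_indicator)
      (auto simp: split_def intro!: continuous_intros)
  moreover obtain I where I: "bochner_has_integral M (\<lambda>x. indicat_real A x *\<^sub>R f x) I"
    using bochner_integrable_indicator[OF f(2) A] unfolding bochner_integrable_def by blast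
  ultimately have "has_bochner_integral M (\<lambda>x. blinfun_apply x' (indicat_real A x *\<^sub>R f x)) (blinfun_apply x' I)"
    by (rule bochner_has_integral_blinfun)
  then have "bochner_has_integral M (\<lambda>x. indicat_real A x *\<^sub>R blinfun_apply x' (f x)) (blinfun_apply x' I)"
    by (simp add: has_bochner_integral_imp_bochner_has_integral blinfun.scaleR_right)
  then show ?thesis
    by (simp only: mean_on_def bochner_integral_eq[OF I] bochner_integral_eq blinfun.scaleR_right)
qed

lemma (in finite_measure) set_integral_blinfun:
  fixes x' :: "'b::banach \<Rightarrow>\<^sub>L real"
  assumes "simple_limit M f" "bochner_integrable M f" "A \<in> sets M"
  shows "(LINT x:A|M. blinfun_apply x' (f x)) = measure M A * blinfun_apply x' (mean_on M A f)"
  unfolding mean_on_blinfun[OF assms, symmetric]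
  by (rule set_integral_eq_measure_mean[OF integrable_blinfun[OF assms(1,2)] assms(3)])

section \<open>Necessity\<close>

text \<open>The setting for representatives; the general functions are replaced by these in the
  final theorem.\<close>

locale bochner_sequence = prob_space M for M :: "'a measure" +
  fixes f :: "nat \<Rightarrow> 'a \<Rightarrow> 'b::banach" and f0 :: "'a \<Rightarrow> 'b"
  assumes f: "\<And>k. simple_limit M (f k)" "\<And>k. bochner_integrable M (f k)"
    and f0: "simple_limit M f0" "bochner_integrable M f0"

context bochner_sequence
begin

lemma pettis_norm_diff_eq:
  "pettis_norm M (\<lambda>x. f k x - f0 x) =
    (SUP x' \<in> cball 0 1. ennreal (\<integral>x. \<bar>blinfun_apply x' (f k x) - blinfun_apply x' (f0 x)\<bar> \<partial>M))"
  unfolding pettis_norm_def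
  using integrable_blinfun[OF f] integrable_blinfun[OF f0]
  by (intro SUP_cong refl) (simp add: blinfun.diff_right nn_integral_eq_integral)

lemma integral_le_pettis_norm:
  assumes "norm x' \<le> 1" and "pettis_norm M (\<lambda>x. f k x - f0 x) \<le> ennreal e" and "e \<ge> 0"
  shows "(\<integral>x. \<bar>blinfun_apply x' (f k x) - blinfun_apply x' (f0 x)\<bar> \<partial>M) \<le> e"
  using assms unfolding pettis_norm_diff_eq SUP_le_iff by (auto simp: ennreal_le_iff)

text \<open>The norming functional of the difference of means changes with \<open>k\<close>, which
  is harmless because the Pettis norm bounds the scalar integrals for all functionals at once.
  Halving \<open>e\<close> yields the strict inequality.\<close>

lemma pettis_convergent_imp_means_tendsto:
  assumes lim: "(\<lambda>k. pettis_norm M (\<lambda>x. f k x - f0 x)) \<longlonglongrightarrow> 0" and B: "B \<in> pos_sets M"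
  shows "(\<lambda>k. norm (mean_on M B (f k) - mean_on M B f0)) \<longlonglongrightarrow> 0"
proof (rule order_tendstoI)
  have Bs: "B \<in> sets M" and pos: "measure M B > 0" using B by (auto simp: pos_sets_def)
  fix e :: real assume "0 < e"
  then have "eventually (\<lambda>k. pettis_norm M (\<lambda>x. f k x - f0 x) < ennreal (e / 2 * measure M B)) sequentially"
    using lim pos by (intro order_tendstoD) auto
  then show "eventually (\<lambda>k. norm (mean_on M B (f k) - mean_on M B f0) < e) sequentially"
  proof eventually_elim
    fix k assume k: "pettis_norm M (\<lambda>x. f k x - f0 x) < ennreal (e / 2 * measure M B)"
    obtain x' :: "'b \<Rightarrow>\<^sub>L real" where x': "norm x' \<le> 1"
      "blinfun_apply x' (mean_on M B (f k) - mean_on M B f0) = norm (mean_on M B (f k) - mean_on M B f0)"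
      by (rule exists_norming_functional)
    let ?g = "\<lambda>x. blinfun_apply x' (f k x)" and ?h = "\<lambda>x. blinfun_apply x' (f0 x)"
    note i = integrable_blinfun[OF f(1,2), of x' k] integrable_blinfun[OF f0, of x']
    have "measure M B * norm (mean_on M B (f k) - mean_on M B f0) = (LINT x:B|M. ?g x) - (LINT x:B|M. ?h x)"
      unfolding x'(2)[symmetric] using i Bs
      by (simp add: set_integral_eq_measure_mean mean_on_blinfun f f0 blinfun.diff_right right_diff_distrib)
    also have "\<dots> = (LINT x:B|M. ?g x - ?h x)"
      using i Bs by (intro set_integral_diff(2)[symmetric] integrable_imp_set_integrable)
    also have "\<dots> \<le> (\<integral>x. \<bar>?g x - ?h x\<bar> \<partial>M)"
      unfolding set_lebesgue_integral_def using i Bs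
      by (intro integral_mono integrable_mult_indicator) (auto simp: indicator_def)
    also have "\<dots> \<le> e / 2 * measure M B"
      using x'(1) k \<open>0 < e\<close> by (intro integral_le_pettis_norm) auto
    finally have "measure M B * norm (mean_on M B (f k) - mean_on M B f0) \<le> measure M B * (e / 2)"
      by (simp add: mult.commute)
    then show "norm (mean_on M B (f k) - mean_on M B f0) < e"
      using pos \<open>0 < e\<close> by simp
  qed
qed (auto intro!: always_eventually intro: less_le_trans)

text \<open>Only finitely many reference functions are used: \<open>f0\<close> for late indices and
  the first \<open>K\<close> terms themselves. The tails of their norms are small at a common level,
  whatever \<open>x'\<close> is.\<close>

lemma pettis_convergent_imp_uniformly_integrable:
  assumes lim: "(\<lambda>k. pettis_norm M (\<lambda>x. f k x - f0 x)) \<longlonglongrightarrow> 0"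
  shows "pettis_uniformly_integrable M (range f)"
  unfolding pettis_uniformly_integrable_def uniformly_integrable_def
proof (rule tendsto_0_ennrealI)
  fix e :: real assume "0 < e"
  have "eventually (\<lambda>k. pettis_norm M (\<lambda>x. f k x - f0 x) < ennreal (e / 4)) sequentially"
    using lim \<open>0 < e\<close> by (intro order_tendstoD) auto
  then obtain K where K: "\<And>k. k \<ge> K \<Longrightarrow> pettis_norm M (\<lambda>x. f k x - f0 x) \<le> ennreal (e / 4)"
    by (auto simp: eventually_sequentially intro: less_imp_le)
  let ?tail = "\<lambda>w c. \<integral>\<^sup>+x\<in>{x. \<bar>w x\<bar> \<ge> c}. ennreal \<bar>w x\<bar> \<partial>M"
  have tail: "eventually (\<lambda>c. ?tail (\<lambda>x. norm (g x)) (c / 2) \<le> ennreal (e / 4)) at_top"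
    if "simple_limit M g" "bochner_integrable M g" for g :: "'a \<Rightarrow> 'b"
  proof -
    have "eventually (\<lambda>c. ?tail (\<lambda>x. norm (g x)) c < ennreal (e / 4)) at_top"
      using \<open>0 < e\<close> tail_integral_tendsto_0[OF bochner_integrable_norm[OF that]]
      by (intro order_tendstoD) auto
    then obtain N where N: "\<And>c. c \<ge> N \<Longrightarrow> ?tail (\<lambda>x. norm (g x)) c < ennreal (e / 4)"
      by (auto simp: eventually_at_top_linorder)
    show ?thesis
      unfolding eventually_at_top_linorder
      by (intro exI[of _ "2 * N"] allI impI order.strict_implies_order[OF N]) simp
  qed
  have "eventually (\<lambda>c. \<forall>k\<in>{..<K}. ?tail (\<lambda>x. norm (f k x)) (c / 2) \<le> ennreal (e / 4)) at_top"
    by (intro eventually_ball_finite ballI tail f) simp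
  moreover have "eventually (\<lambda>c. ?tail (\<lambda>x. norm (f0 x)) (c / 2) \<le> ennreal (e / 4)) at_top"
    by (intro tail f0)
  ultimately show "eventually (\<lambda>c. (SUP h\<in>{(\<lambda>x. blinfun_apply x' (g x)) | x' g. x' \<in> cball (0 :: 'b \<Rightarrow>\<^sub>L real) 1 \<and> g \<in> range f}.
      ?tail h c) \<le> ennreal e) at_top"
  proof eventually_elim
    fix c assume c: "\<forall>k\<in>{..<K}. ?tail (\<lambda>x. norm (f k x)) (c / 2) \<le> ennreal (e / 4)"
      "?tail (\<lambda>x. norm (f0 x)) (c / 2) \<le> ennreal (e / 4)"
    have "?tail (\<lambda>x. blinfun_apply x' (f k x)) c \<le> ennreal e" if x': "norm x' \<le> 1" for x' :: "'b \<Rightarrow>\<^sub>L real" and k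
    proof -
      have m: "(\<lambda>x. blinfun_apply x' (g x)) \<in> borel_measurable M" "(\<lambda>x. norm (g x)) \<in> borel_measurable M"
        if "simple_limit M g" "bochner_integrable M g" for g :: "'a \<Rightarrow> 'b"
        using integrable_blinfun[OF that] bochner_integrable_norm[OF that] by auto
      have e: "2 * ennreal (e / 4) + 2 * ennreal (e / 4) = ennreal e"
        using \<open>0 < e\<close> by (simp flip: ennreal_numeral ennreal_mult ennreal_plus)
      \<comment> \<open>For \<open>k < K\<close> the reference is \<open>f k\<close>, at distance 0;
        later it is \<open>f0\<close>, within \<open>e / 4\<close> in Pettis norm.\<close>
      obtain g where g: "simple_limit M g" "bochner_integrable M g"
        "(\<integral>\<^sup>+x. ennreal \<bar>blinfun_apply x' (f k x) - blinfun_apply x' (g x)\<bar> \<partial>M) \<le> ennreal (e / 4)"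
        "?tail (\<lambda>x. norm (g x)) (c / 2) \<le> ennreal (e / 4)"
      proof (cases "k < K")
        case True
        with c(1) f \<open>0 < e\<close> show ?thesis by (intro that[of "f k"]) auto
      next
        case False
        show ?thesis
        proof (rule that[OF f0 _ c(2)])
          have "(\<integral>\<^sup>+x. ennreal \<bar>blinfun_apply x' (f k x) - blinfun_apply x' (f0 x)\<bar> \<partial>M) \<le> pettis_norm M (\<lambda>x. f k x - f0 x)"
            unfolding pettis_norm_def using x' by (intro SUP_upper2[of x']) (auto simp: blinfun.diff_right)
          also have "\<dots> \<le> ennreal (e / 4)" using K False by simp
          finally show "(\<integral>\<^sup>+x. ennreal \<bar>blinfun_apply x' (f k x) - blinfun_apply x' (f0 x)\<bar> \<partial>M) \<le> ennreal (e / 4)" .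
        qed
      qed
      have "?tail (\<lambda>x. blinfun_apply x' (f k x)) c \<le>
          2 * (\<integral>\<^sup>+x. ennreal \<bar>blinfun_apply x' (f k x) - blinfun_apply x' (g x)\<bar> \<partial>M)
          + 2 * ?tail (\<lambda>x. norm (g x)) (c / 2)"
        by (intro tail_integral_le m f g abs_blinfun_le_norm[OF x'])
      also have "\<dots> \<le> ennreal e"
        unfolding e[symmetric] using g by (intro add_mono mult_left_mono) auto
      finally show ?thesis .
    qed
    then show "(SUP h\<in>{(\<lambda>x. blinfun_apply x' (g x)) | x' g. x' \<in> cball (0 :: 'b \<Rightarrow>\<^sub>L real) 1 \<and> g \<in> range f}.
      ?tail h c) \<le> ennreal e"
      by (intro SUP_least) auto
  qed
qed

text \<open>Take a simple function whose \<open>L1\<close> distance to \<open>f0\<close> is below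
  \<open>e * measure M B\<close>. If every set failed, each level set inside \<open>B\<close> would
  contribute at least \<open>e\<close> times its measure to that distance, and the sum would
  contradict the choice.\<close>

lemma exists_almost_constant:
  assumes B: "B \<in> pos_sets M" and "e > 0"
  obtains A v where "A \<in> pos_sets M" "A \<subseteq> B" "(LINT x:A|M. norm (f0 x - v)) \<le> e * measure M A"
proof (rule ccontr)
  assume "\<not> thesis"
  with that have no: "(LINT x:A|M. norm (f0 x - v)) > e * measure M A" if "A \<in> pos_sets M" "A \<subseteq> B" for A v
    using that by (meson not_less)
  have Bs: "B \<in> sets M" and pos: "measure M B > 0" using B by (auto simp: pos_sets_def)
  obtain s where s: "\<And>i::nat. Bochner_Integration.simple_bochner_integrable M (s i)"
    and s0: "(\<lambda>i. \<integral>\<^sup>+x. ennreal (norm (f0 x - s i x)) \<partial>M) \<longlonglongrightarrow> 0"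
    using f0(2) unfolding bochner_integrable_def bochner_has_integral_def by blast
  have "eventually (\<lambda>i. (\<integral>\<^sup>+x. ennreal (norm (f0 x - s i x)) \<partial>M) < ennreal (e * measure M B)) sequentially"
    using s0 pos \<open>e > 0\<close> by (intro order_tendstoD) auto
  then obtain i where i: "(\<integral>\<^sup>+x. ennreal (norm (f0 x - s i x)) \<partial>M) < ennreal (e * measure M B)"
    by (auto simp: eventually_sequentially)
  have sf: "simple_function M (s i)"
    using s by (auto elim: simple_bochner_integrable.cases)
  have int: "integrable M (\<lambda>x. norm (f0 x - s i x))"
  proof (rule integrableI_bounded)
    show "(\<lambda>x. norm (f0 x - s i x)) \<in> borel_measurable M"
      by (intro simple_limit_borel_measurable simple_limit_compose2[OF f0(1) simple_limit_simple[OF sf], where h = "\<lambda>x y. norm (x - y)"])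
         (auto simp: split_def intro!: continuous_intros)
    show "(\<integral>\<^sup>+x. ennreal (norm (norm (f0 x - s i x))) \<partial>M) < \<infinity>"
      using i less_trans[OF i ennreal_less_top] by simp
  qed
  define D where "D v = B \<inter> (s i -` {v} \<inter> space M)" for v
  have D: "D v \<in> sets M" for v
    unfolding D_def by (intro sets.Int Bs simple_functionD(2)[OF sf])
  have fin: "finite (s i ` space M)" using sf by (simp add: simple_function_def)
  have UD: "(\<Union>v\<in>s i ` space M. D v) = B" using sets.sets_into_space[OF Bs] by (auto simp: D_def)
  have dD: "disjoint_family_on D (s i ` space M)" by (auto simp: disjoint_family_on_def D_def)
  have "e * measure M B = (\<Sum>v\<in>s i ` space M. e * measure M (D v))"
    using finite_measure_finite_Union[OF fin _ dD] D unfolding UD sum_distrib_left[symmetric] by auto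
  also have "\<dots> \<le> (\<Sum>v\<in>s i ` space M. LINT x:D v|M. norm (f0 x - v))"
  proof (rule sum_mono)
    fix v
    show "e * measure M (D v) \<le> (LINT x:D v|M. norm (f0 x - v))"
    proof (cases "D v \<in> pos_sets M")
      case True
      then show ?thesis using no[of "D v" v] by (auto simp: D_def)
    next
      case False
      then have "measure M (D v) = 0" using D by (simp add: pos_sets_def order_le_less zero_less_measure_iff)
      then show ?thesis by (simp add: set_lebesgue_integral_def)
    qed
  qed
  also have "\<dots> = (\<Sum>v\<in>s i ` space M. LINT x:D v|M. norm (f0 x - s i x))"
    unfolding set_lebesgue_integral_def
    by (intro sum.cong refl Bochner_Integration.integral_cong) (auto simp: D_def indicator_def)
  also have "\<dots> = (LINT x:B|M. norm (f0 x - s i x))"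
    unfolding UD[symmetric]
    by (intro set_integral_finite_Union[symmetric] fin dD integrable_imp_set_integrable D int)
  also have "\<dots> \<le> (\<integral>x. norm (f0 x - s i x) \<partial>M)"
    unfolding set_lebesgue_integral_def using int Bs
    by (intro integral_mono integrable_mult_indicator) (auto simp: indicator_def)
  finally have "ennreal (e * measure M B) \<le> (\<integral>\<^sup>+x. ennreal (norm (f0 x - s i x)) \<partial>M)"
    by (subst nn_integral_eq_integral[OF int]) (auto intro: ennreal_leI)
  with i show False by simp
qed

text \<open>Where \<open>f0\<close> is nearly the vector \<open>v\<close>, the scalar function
  \<open>x'(f0)\<close> is nearly \<open>x' v\<close>, so the same \<open>A\<close> serves all
  \<open>x'\<close>. Replacing the mean by \<open>x' v\<close> costs a factor 2: the total is
  \<open>2 * (e / 8 + e / 8) = e / 2\<close>. The bound holds eventually, so it limits even the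
  \<open>limsup\<close>.\<close>

lemma pettis_convergent_imp_seq_pettis_bocce:
  assumes lim: "(\<lambda>k. pettis_norm M (\<lambda>x. f k x - f0 x)) \<longlonglongrightarrow> 0"
  shows "seq_pettis_bocce M f"
  unfolding seq_pettis_bocce_def
proof (intro allI impI ballI)
  fix r :: "nat \<Rightarrow> nat" and e :: real and B
  assume r: "strict_mono r" and e: "0 < e" and B: "B \<in> pos_sets M"
  obtain A v where A: "A \<in> pos_sets M" "A \<subseteq> B" and v: "(LINT x:A|M. norm (f0 x - v)) \<le> e / 8 * measure M A"
    using exists_almost_constant[OF B, of "e / 8"] e by auto
  have As: "A \<in> sets M" and pos: "measure M A > 0" using A by (auto simp: pos_sets_def)
  have "eventually (\<lambda>k. pettis_norm M (\<lambda>x. f k x - f0 x) < ennreal (e / 8 * measure M A)) sequentially"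
    using lim e pos by (intro order_tendstoD) auto
  then have "eventually (\<lambda>j. pettis_norm M (\<lambda>x. f (r j) x - f0 x) < ennreal (e / 8 * measure M A)) sequentially"
    using r by (rule eventually_subseq[rotated])
  then have "eventually (\<lambda>j. pettis_bocce_osc M A (f (r j)) \<le> ennreal (e / 2)) sequentially"
  proof eventually_elim
    fix j
    define k where "k = r j"
    assume "pettis_norm M (\<lambda>x. f (r j) x - f0 x) < ennreal (e / 8 * measure M A)"
    then have p: "pettis_norm M (\<lambda>x. f k x - f0 x) \<le> ennreal (e / 8 * measure M A)" by (simp add: k_def)
    have "bocce_osc M A (\<lambda>x. blinfun_apply x' (f k x)) \<le> ennreal (e / 2)" if x': "norm x' \<le> 1" for x' :: "'b \<Rightarrow>\<^sub>L real"
    proof -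
      let ?g = "\<lambda>x. blinfun_apply x' (f k x)" and ?h = "\<lambda>x. blinfun_apply x' (f0 x)"
      note i = integrable_blinfun[OF f(1,2), of x' k] integrable_blinfun[OF f0, of x']
      have n: "integrable M (\<lambda>x. norm (f0 x - v))"
      proof (rule Bochner_Integration.integrable_bound)
        show "integrable M (\<lambda>x. norm (f0 x) + norm v)" using bochner_integrable_norm[OF f0] by simp
        show "(\<lambda>x. norm (f0 x - v)) \<in> borel_measurable M"
          by (intro simple_limit_borel_measurable simple_limit_compose[OF f0(1)] continuous_intros)
      qed (auto intro: norm_triangle_ineq4)
      have "(LINT x:A|M. \<bar>?g x - mean_on M A ?g\<bar>) \<le> 2 * (LINT x:A|M. \<bar>?g x - blinfun_apply x' v\<bar>)"
        by (intro set_integral_abs_diff_mean_le i As)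
      also have "(LINT x:A|M. \<bar>?g x - blinfun_apply x' v\<bar>) \<le> (LINT x:A|M. \<bar>?g x - ?h x\<bar> + norm (f0 x - v))"
      proof (intro set_integral_mono integrable_imp_set_integrable As)
        show "\<bar>?g x - blinfun_apply x' v\<bar> \<le> \<bar>?g x - ?h x\<bar> + norm (f0 x - v)" for x
          using abs_blinfun_le_norm[OF x', of "f0 x - v"] by (simp add: blinfun.diff_right)
      qed (use i n in auto)
      also have "\<dots> = (LINT x:A|M. \<bar>?g x - ?h x\<bar>) + (LINT x:A|M. norm (f0 x - v))"
        using i n As by (intro set_integral_add integrable_imp_set_integrable) auto
      also have "(LINT x:A|M. \<bar>?g x - ?h x\<bar>) \<le> (\<integral>x. \<bar>?g x - ?h x\<bar> \<partial>M)"
        unfolding set_lebesgue_integral_def using i As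
        by (intro integral_mono integrable_mult_indicator) (auto simp: indicator_def)
      also have "\<dots> \<le> e / 8 * measure M A"
        using x' p e by (intro integral_le_pettis_norm) auto
      finally have "(LINT x:A|M. \<bar>?g x - mean_on M A ?g\<bar>) \<le> e / 2 * measure M A"
        using v by simp
      then show ?thesis
        using pos e by (simp add: bocce_osc_real[OF i(1) As pos] pos_divide_le_eq ennreal_leI)
    qed
    then show "pettis_bocce_osc M A (f (r j)) \<le> ennreal (e / 2)"
      unfolding pettis_bocce_osc_def k_def[symmetric] by (intro SUP_least) auto
  qed
  then have "limsup (\<lambda>j. pettis_bocce_osc M A (f (r j))) \<le> ennreal (e / 2)"
    by (rule Limsup_bounded)
  then have "liminf (\<lambda>j. pettis_bocce_osc M A (f (r j))) \<le> ennreal (e / 2)"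
    using Liminf_le_Limsup[OF trivial_limit_sequentially] order_trans by blast
  also have "\<dots> < ennreal e" using e by (simp add: ennreal_less_iff)
  finally show "\<exists>A\<in>pos_sets M. A \<subseteq> B \<and> liminf (\<lambda>j. pettis_bocce_osc M A (f (r j))) < ennreal e"
    using A by blast
qed

section \<open>Sufficiency\<close>

text \<open>The criterion in the form of a thinning of index sets, as the exhaustion requires: it is
  applied to the increasing enumeration of \<open>S\<close>. Were the good indices finite in number,
  the \<open>liminf\<close> would be at least \<open>e\<close>.\<close>

lemma seq_pettis_bocce_infinite:
  assumes "seq_pettis_bocce M f" and S: "infinite S" and B: "B \<in> pos_sets M" and e: "e > 0"
  shows "\<exists>A\<in>pos_sets M. A \<subseteq> B \<and> infinite {k \<in> S. pettis_bocce_osc M A (f k) < ennreal e}"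
proof -
  have r: "strict_mono (enumerate S)" using S by (simp add: strict_mono_enumerate)
  then obtain A where A: "A \<in> pos_sets M" "A \<subseteq> B"
    and lt: "liminf (\<lambda>j. pettis_bocce_osc M A (f (enumerate S j))) < ennreal e"
    using assms unfolding seq_pettis_bocce_def by blast
  have "infinite {j. pettis_bocce_osc M A (f (enumerate S j)) < ennreal e}" (is "infinite ?J")
  proof
    assume "finite ?J"
    then have "eventually (\<lambda>j. ennreal e \<le> pettis_bocce_osc M A (f (enumerate S j))) sequentially"
      by (simp add: eventually_cofinite flip: cofinite_eq_sequentially)
         (simp add: not_le)
    then have "ennreal e \<le> liminf (\<lambda>j. pettis_bocce_osc M A (f (enumerate S j)))"
      by (rule Liminf_bounded)
    with lt show False by simp
  qed
  then have "infinite (enumerate S ` ?J)"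
    using strict_mono_imp_inj_on[OF r] by (metis finite_imageD inj_on_subset subset_UNIV)
  moreover have "enumerate S ` ?J \<subseteq> {k \<in> S. pettis_bocce_osc M A (f k) < ennreal e}"
    using S by (auto intro: enumerate_in_set)
  ultimately show ?thesis
    using A infinite_super by blast
qed

lemma pettis_uniformly_integrable_tail:
  assumes "pettis_uniformly_integrable M (range f)" and "e > 0"
  obtains c where "c \<ge> 0" "\<And>k (x' :: 'b \<Rightarrow>\<^sub>L real). norm x' \<le> 1 \<Longrightarrow>
    (\<integral>\<^sup>+x\<in>{x. \<bar>blinfun_apply x' (f k x)\<bar> \<ge> c}. ennreal \<bar>blinfun_apply x' (f k x)\<bar> \<partial>M) \<le> ennreal e"
proof -
  let ?H = "{(\<lambda>x. blinfun_apply x' (g x)) | x' g. x' \<in> cball (0 :: 'b \<Rightarrow>\<^sub>L real) 1 \<and> g \<in> range f}"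
  have "eventually (\<lambda>c. (SUP h\<in>?H. \<integral>\<^sup>+x\<in>{x. \<bar>h x\<bar> \<ge> c}. ennreal \<bar>h x\<bar> \<partial>M) < ennreal e) at_top"
    using assms unfolding pettis_uniformly_integrable_def uniformly_integrable_def
    by (intro order_tendstoD) auto
  then have "eventually (\<lambda>c. c \<ge> 0 \<and> (SUP h\<in>?H. \<integral>\<^sup>+x\<in>{x. \<bar>h x\<bar> \<ge> c}. ennreal \<bar>h x\<bar> \<partial>M) < ennreal e) at_top"
    using eventually_ge_at_top[of 0] by eventually_elim simp
  then obtain c :: real where c: "c \<ge> 0" "(SUP h\<in>?H. \<integral>\<^sup>+x\<in>{x. \<bar>h x\<bar> \<ge> c}. ennreal \<bar>h x\<bar> \<partial>M) < ennreal e"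
    by (auto simp: eventually_at_top_linorder)
  show ?thesis
  proof (rule that[OF c(1)])
    fix k and x' :: "'b \<Rightarrow>\<^sub>L real" assume "norm x' \<le> 1"
    then have "(\<lambda>x. blinfun_apply x' (f k x)) \<in> ?H" by auto
    from order.trans[OF SUP_upper[OF this] less_imp_le[OF c(2)]]
    show "(\<integral>\<^sup>+x\<in>{x. \<bar>blinfun_apply x' (f k x)\<bar> \<ge> c}. ennreal \<bar>blinfun_apply x' (f k x)\<bar> \<partial>M) \<le> ennreal e" .
  qed
qed

text \<open>On a set of positive measure the integral is the measure times \<open>x'\<close> of the
  mean; on a null set both sides are 0.\<close>

lemma set_integral_blinfun_tendsto:
  fixes x' :: "'b \<Rightarrow>\<^sub>L real"
  assumes lim: "\<And>B. B \<in> pos_sets M \<Longrightarrow> (\<lambda>k. norm (mean_on M B (f k) - mean_on M B f0)) \<longlonglongrightarrow> 0"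
    and B: "B \<in> sets M"
  shows "(\<lambda>k. LINT x:B|M. blinfun_apply x' (f k x)) \<longlonglongrightarrow> (LINT x:B|M. blinfun_apply x' (f0 x))"
  unfolding set_integral_blinfun[OF f B] set_integral_blinfun[OF f0 B]
proof (cases "B \<in> pos_sets M")
  case True
  have "(\<lambda>k. mean_on M B (f k)) \<longlonglongrightarrow> mean_on M B f0"
    using lim[OF True] by (simp add: LIM_zero_iff tendsto_norm_zero_iff)
  then show "(\<lambda>k. measure M B * blinfun_apply x' (mean_on M B (f k))) \<longlonglongrightarrow> measure M B * blinfun_apply x' (mean_on M B f0)"
    by (intro tendsto_intros)
next
  case False
  then have "measure M B = 0" using B by (simp add: pos_sets_def order_le_less zero_less_measure_iff)
  then show "(\<lambda>k. measure M B * blinfun_apply x' (mean_on M B (f k))) \<longlonglongrightarrow> measure M B * blinfun_apply x' (mean_on M B f0)"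
    by simp
qed

lemma pettis_convergence_sufficient:
  assumes ui: "pettis_uniformly_integrable M (range f)" and bocce: "seq_pettis_bocce M f"
    and means: "\<And>B. B \<in> pos_sets M \<Longrightarrow> (\<lambda>k. norm (mean_on M B (f k) - mean_on M B f0)) \<longlonglongrightarrow> 0"
  shows "(\<lambda>k. pettis_norm M (\<lambda>x. f k x - f0 x)) \<longlonglongrightarrow> 0"
proof (rule tendsto_0_ennrealI, rule ccontr)
  fix e :: real
  assume "0 < e" and neg: "\<not> eventually (\<lambda>k. pettis_norm M (\<lambda>x. f k x - f0 x) \<le> ennreal e) sequentially"
  \<comment> \<open>Budget in units of \<open>a\<close>: 2 for the oscillations of the term and of
    the limit, 1 for the means, and 2 for each of the two integrals over the uncovered set.\<close>
  define a where "a = e / 7"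
  have a: "a > 0" using \<open>0 < e\<close> by (simp add: a_def)
  define S0 where "S0 = {k. \<not> pettis_norm M (\<lambda>x. f k x - f0 x) \<le> ennreal e}"
  have S0: "infinite S0"
    using neg unfolding S0_def cofinite_eq_sequentially[symmetric] eventually_cofinite by blast
  \<comment> \<open>This is the convention \<open>0 / 0 = 0\<close>.\<close>
  have osc_empty: "pettis_bocce_osc M {} (f k) < ennreal a" for k
    using a by (simp add: pettis_bocce_osc_def bocce_osc_def)
  obtain A :: "nat \<Rightarrow> 'a set" and d :: "nat \<Rightarrow> nat" where A: "range A \<subseteq> sets M" "disjoint_family A" and d: "strict_mono d" "\<And>j. d j \<in> S0"
    and osc: "\<And>n j. n \<le> j \<Longrightarrow> pettis_bocce_osc M (A n) (f (d j)) < ennreal a"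
    and null: "measure M (space M - (\<Union>n. A n)) = 0"
  proof (rule exhaustion_diagonal[where Q = "\<lambda>A k. pettis_bocce_osc M A (f k) < ennreal a", OF osc_empty _ S0])
    note diag = that
    show "\<exists>A\<in>pos_sets M. A \<subseteq> B \<and> infinite {k \<in> S. pettis_bocce_osc M A (f k) < ennreal a}"
      if "infinite S" "B \<in> pos_sets M" for S B
      by (rule seq_pettis_bocce_infinite[OF bocce that a])
    show thesis if h: "range A \<subseteq> sets M" "disjoint_family A" "strict_mono d" "\<And>j. d j \<in> S0"
      "\<And>n j. n \<le> j \<Longrightarrow> pettis_bocce_osc M (A n) (f (d j)) < ennreal a"
      "measure M (space M - (\<Union>n. A n)) = 0" for A :: "nat \<Rightarrow> 'a set" and d :: "nat \<Rightarrow> nat"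
      by (rule diag[OF h])
  qed
  have As: "A n \<in> sets M" for n using A by auto
  obtain c where c: "c \<ge> 0" and tail: "\<And>k (x' :: 'b \<Rightarrow>\<^sub>L real). norm x' \<le> 1 \<Longrightarrow>
    (\<integral>\<^sup>+x\<in>{x. \<bar>blinfun_apply x' (f k x)\<bar> \<ge> c}. ennreal \<bar>blinfun_apply x' (f k x)\<bar> \<partial>M) \<le> ennreal a"
    using pettis_uniformly_integrable_tail[OF ui a] by blast
  have "(\<lambda>N. measure M (\<Union>n<N. A n)) \<longlonglongrightarrow> measure M (\<Union>N. \<Union>n<N. A n)"
    using As by (intro finite_Lim_measure_incseq monoI UN_mono) auto
  moreover have "(\<Union>N. \<Union>n<N. A n) = (\<Union>n. A n)" by auto
  moreover have "measure M (\<Union>n. A n) = 1"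
    using null As prob_compl[of "\<Union>n. A n"] by auto
  ultimately have "(\<lambda>N. measure M (\<Union>n<N. A n)) \<longlonglongrightarrow> 1" by simp
  \<comment> \<open>The level \<open>c\<close> is fixed first, then \<open>N\<close>, so that the
    uncovered measure times \<open>c\<close> is at most \<open>a\<close>. The denominator
    \<open>c + 1\<close> also serves \<open>c = 0\<close>.\<close>
  moreover have "1 - a / (c + 1) < 1" using a c by simp
  ultimately have "eventually (\<lambda>N. 1 - a / (c + 1) < measure M (\<Union>n<N. A n)) sequentially"
    by (rule order_tendstoD)
  then obtain N where N: "1 - a / (c + 1) < measure M (\<Union>n<N. A n)"
    by (auto simp: eventually_sequentially)
  define R where "R = space M - (\<Union>n<N. A n)"
  have R: "R \<in> sets M" using As by (auto simp: R_def)
  have "measure M R < a / (c + 1)"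
    using N As prob_compl[of "\<Union>n<N. A n"] by (auto simp: R_def)
  then have "c * measure M R \<le> c * (a / (c + 1))" using c by (intro mult_left_mono) auto
  also have "\<dots> \<le> a" using a c by (simp add: field_simps)
  finally have cR: "c * measure M R \<le> a" .
  \<comment> \<open>Taken with norms of vector means, so that one index \<open>j\<close> is good for
    every \<open>x'\<close>.\<close>
  define \<delta> where "\<delta> j = (\<Sum>n<N. measure M (A n) * norm (mean_on M (A n) (f (d j)) - mean_on M (A n) f0))" for j
  have "\<delta> \<longlonglongrightarrow> (\<Sum>n<N. 0)"
    unfolding \<delta>_def
  proof (intro tendsto_sum)
    fix n
    show "(\<lambda>j. measure M (A n) * norm (mean_on M (A n) (f (d j)) - mean_on M (A n) f0)) \<longlonglongrightarrow> 0"
    proof (cases "A n \<in> pos_sets M")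
      case True
      then show ?thesis
        using LIMSEQ_subseq_LIMSEQ[OF means[OF True] d(1)] by (auto simp: o_def intro: tendsto_mult_right_zero)
    next
      case False
      then have "measure M (A n) = 0" using As by (simp add: pos_sets_def order_le_less zero_less_measure_iff)
      then show ?thesis by simp
    qed
  qed
  then have "eventually (\<lambda>j. \<delta> j < a) sequentially"
    using a by (intro order_tendstoD) auto
  \<comment> \<open>\<open>N \<le> j\<close> puts all of the first \<open>N\<close> oscillation
    bounds in force at \<open>d j\<close>.\<close>
  then obtain j where j: "N \<le> j" "\<delta> j < a"
    unfolding eventually_sequentially by (meson nat_le_linear order_refl)
  have sumA: "(\<Sum>n<N. measure M (A n)) \<le> 1"
  proof -
    have "disjoint_family_on A {..<N}" using A(2) by (rule disjoint_family_on_mono[rotated]) simp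
    then have "(\<Sum>n<N. measure M (A n)) = measure M (\<Union>n<N. A n)"
      using As by (intro finite_measure_finite_Union[symmetric]) auto
    then show ?thesis using prob_le_1 by simp
  qed
  have "(\<integral>x. \<bar>blinfun_apply x' (f (d j) x) - blinfun_apply x' (f0 x)\<bar> \<partial>M) \<le> e" if x': "norm x' \<le> 1" for x' :: "'b \<Rightarrow>\<^sub>L real"
  proof -
    let ?g = "\<lambda>k x. blinfun_apply x' (f k x)" and ?h = "\<lambda>x. blinfun_apply x' (f0 x)"
    have ig: "integrable M (?g k)" for k by (rule integrable_blinfun[OF f])
    have ig0: "integrable M ?h" by (rule integrable_blinfun[OF f0])
    have lim: "(\<lambda>j. LINT x:B|M. ?g (d j) x) \<longlonglongrightarrow> (LINT x:B|M. ?h x)" if "B \<in> sets M" for B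
      using LIMSEQ_subseq_LIMSEQ[OF set_integral_blinfun_tendsto[OF means that] d(1)] by (simp add: o_def)
    have oscA: "(LINT x:A n|M. \<bar>?g (d i) x - mean_on M (A n) (?g (d i))\<bar>) \<le> a * measure M (A n)" if "n \<le> i" for n i
    proof (rule bocce_osc_le_imp_set_integral_le[OF ig As])
      have "bocce_osc M (A n) (?g (d i)) \<le> pettis_bocce_osc M (A n) (f (d i))"
        unfolding pettis_bocce_osc_def using x' by (intro SUP_upper) auto
      then show "bocce_osc M (A n) (?g (d i)) \<le> ennreal a"
        using osc[OF that] by simp
    qed (use a in simp)
    \<comment> \<open>For fixed \<open>n\<close> the bound holds along \<open>d\<close> from index
      \<open>n\<close> on, and the scalar means converge too; so semicontinuity with moving
      constants applies.\<close>
    have osc0: "(LINT x:A n|M. \<bar>?h x - mean_on M (A n) ?h\<bar>) \<le> a * measure M (A n)" for n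
    proof (rule set_integral_abs_diff_le_of_tendsto[OF ig ig0 lim _ As])
      show "(\<lambda>i. mean_on M (A n) (?g (d i))) \<longlonglongrightarrow> mean_on M (A n) ?h"
        unfolding mean_on_real[OF ig As] mean_on_real[OF ig0 As] divide_inverse
        by (intro tendsto_mult_right lim As)
      show "eventually (\<lambda>i. (LINT x:A n|M. \<bar>?g (d i) x - mean_on M (A n) (?g (d i))\<bar>) \<le> a * measure M (A n)) sequentially"
        using eventually_ge_at_top[of n] by eventually_elim (rule oscA)
    qed
    have R1: "(LINT x:R|M. \<bar>?g k x\<bar>) \<le> 2 * a" for k
      using set_integral_abs_le_tail[OF ig R c tail[OF x', of k]] a cR by simp
    \<comment> \<open>The same semicontinuity with constant 0 gives the limit function the remainder
      bound of the sequence.\<close>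
    have R0: "(LINT x:R|M. \<bar>?h x\<bar>) \<le> 2 * a"
      using set_integral_abs_diff_le_of_tendsto[OF ig ig0 lim tendsto_const[of 0] R, of "2 * a"] R1 by simp
    have "(\<integral>x. \<bar>?g (d j) x - ?h x\<bar> \<partial>M) \<le>
      (\<Sum>n<N. (LINT x:A n|M. \<bar>?g (d j) x - mean_on M (A n) (?g (d j))\<bar>) + (LINT x:A n|M. \<bar>?h x - mean_on M (A n) ?h\<bar>)
          + measure M (A n) * \<bar>mean_on M (A n) (?g (d j)) - mean_on M (A n) ?h\<bar>)
      + ((LINT x:R|M. \<bar>?g (d j) x\<bar>) + (LINT x:R|M. \<bar>?h x\<bar>))"
      unfolding R_def by (rule integral_abs_diff_le_partition[OF ig ig0 As A(2)])
    also have "\<dots> \<le> (\<Sum>n<N. a * measure M (A n) + a * measure M (A n)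
          + measure M (A n) * norm (mean_on M (A n) (f (d j)) - mean_on M (A n) f0))
      + (2 * a + 2 * a)"
    proof (intro add_mono sum_mono oscA osc0 R1 R0 mult_left_mono)
      fix n assume "n \<in> {..<N}"
      then show "n \<le> j" using j by simp
      show "\<bar>mean_on M (A n) (?g (d j)) - mean_on M (A n) ?h\<bar> \<le> norm (mean_on M (A n) (f (d j)) - mean_on M (A n) f0)"
        using abs_blinfun_le_norm[OF x'] by (simp add: mean_on_blinfun f f0 As flip: blinfun.diff_right)
    qed simp
    also have "\<dots> = 2 * (a * (\<Sum>n<N. measure M (A n))) + \<delta> j + 4 * a"
      by (simp add: \<delta>_def sum.distrib sum_distrib_left)
    also have "\<dots> \<le> 2 * (a * 1) + a + 4 * a"
      using a j(2) sumA by (intro add_mono mult_left_mono) auto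
    finally show ?thesis by (simp add: a_def)
  qed
  then have "pettis_norm M (\<lambda>x. f (d j) x - f0 x) \<le> ennreal e"
    unfolding pettis_norm_diff_eq by (intro SUP_least ennreal_leI) auto
  then show False using d(2)[of j] by (simp add: S0_def)
qed

end

theorem theorem5p11:
  fixes M :: "'a measure"
    and f :: "nat \<Rightarrow> 'a \<Rightarrow> 'b::banach"
    and f0 :: "'a \<Rightarrow> 'b"
  assumes "prob_space M"
    and "\<And>k. bochner_integrable M (f k)"
    and "bochner_integrable M f0"
  shows "(\<lambda>k. pettis_norm M (\<lambda>x. f k x - f0 x)) \<longlonglongrightarrow> 0 \<longleftrightarrow>
    pettis_uniformly_integrable M (range f) \<and>
    seq_pettis_bocce M f \<and>
    (\<forall>B \<in> pos_sets M. (\<lambda>k. norm (mean_on M B (f k) - mean_on M B f0)) \<longlonglongrightarrow> 0)"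
proof -
  have repr: "\<exists>g. simple_limit M g \<and> (AE x in M. h x = g x)" if "bochner_integrable M h" for h :: "'a \<Rightarrow> 'b"
    using that simple_limit_representative unfolding bochner_integrable_def bochner_has_integral_def by metis
  obtain g where g: "\<And>k. simple_limit M (g k)" and fg: "\<And>k. AE x in M. f k x = g k x"
    using repr[OF assms(2)] by metis
  obtain g0 where g0: "simple_limit M g0" and fg0: "AE x in M. f0 x = g0 x"
    using repr[OF assms(3)] by metis
  interpret prob_space M by fact
  interpret bochner_sequence M g g0
    using g g0 assms(2,3) bochner_integrable_cong_AE[OF fg] bochner_integrable_cong_AE[OF fg0]
    by unfold_locales auto
  have "AE x in M. f k x - f0 x = g k x - g0 x" for k
    using fg[of k] fg0 by eventually_elim simp
  from pettis_norm_cong_AE[OF this]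
  show ?thesis
    unfolding pettis_uniformly_integrable_cong_AE[OF fg] seq_pettis_bocce_def
      pettis_bocce_osc_cong_AE[OF fg] mean_on_cong_AE[OF fg] mean_on_cong_AE[OF fg0]
    unfolding seq_pettis_bocce_def[symmetric]
    using pettis_convergent_imp_uniformly_integrable pettis_convergent_imp_seq_pettis_bocce
      pettis_convergent_imp_means_tendsto pettis_convergence_sufficient
    by auto
qed

end
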